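(* For $\Re s>1$, \[ \Gamma(s/2)Z(s)=\int_0^{+\infty}f(x)\,x^{\frac{s}{2}}\frac{dx}{x}. \]
   Context: Let the zeros $\rho$ of the Riemann zeta function with $\Im\rho>0$ be arranged in a sequence $(\rho_n)_{n\ge1}$ with $\Im\rho_{n+1}\ge\Im\rho_n$, each zero repeated according to its multiplicity, and write $\rho_n=\frac12+i\alpha_n$ (so $\Re\alpha_n>0$; the Riemann Hypothesis is not assumed). Powers $\alpha_n^{-s}$ use the principal branch. The secondary zeta function is $Z(s)=\sum_{n=1}^\infty\alpha_n^{-s}$ for $\Re s>1$, and for $\Re z>0$ we set $f(z)=\sum_{n=1}^\infty e^{-\alpha_n^2 z}$ (a holomorphic function on $\Re z>0$). *)

theory Defs
  imports "HOL-Complex_Analysis.Complex_Analysis"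
begin

text \<open>
  The Riemann zeta function is the analytic continuation of its Dirichlet series to the plane
  without the point 1. Such a continuation is unique away from 1; its value at 1 is irrelevant.
\<close>
definition riemann_zeta :: "complex \<Rightarrow> complex" where
  "riemann_zeta = (SOME g. g holomorphic_on (- {1}) \<and>
     (\<forall>s. Re s > 1 \<longrightarrow> g s = (\<Sum>n. of_nat (Suc n) powr (- s))))"

text \<open>
  Sequences are indexed from 0, so \<open>\<rho> n\<close> stands for the zero usually written with index \<open>n + 1\<close>.
\<close>
definition upper_zeta_zeros :: "(nat \<Rightarrow> complex) \<Rightarrow> bool" where
  "upper_zeta_zeros \<rho> \<longleftrightarrow>
     (\<forall>n. riemann_zeta (\<rho> n) = 0 \<and> Im (\<rho> n) > 0) \<and>
     (\<forall>n. Im (\<rho> n) \<le> Im (\<rho> (Suc n))) \<and>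
     (\<forall>z. riemann_zeta z = 0 \<and> Im z > 0 \<longrightarrow>
        finite {n. \<rho> n = z} \<and> int (card {n. \<rho> n = z}) = zorder riemann_zeta z)"

definition secondary_zeta :: "(nat \<Rightarrow> complex) \<Rightarrow> complex \<Rightarrow> complex" where
  "secondary_zeta \<alpha> s = (\<Sum>n. \<alpha> n powr (- s))"

definition zeros_theta :: "(nat \<Rightarrow> complex) \<Rightarrow> complex \<Rightarrow> complex" where
  "zeros_theta \<alpha> z = (\<Sum>n. exp (- ((\<alpha> n)\<^sup>2 * z)))"

end

theory Submission
  imports Defs
begin

text \<open>
  Integrating term by term reduces the identity to
  \<open>\<integral> e\<^sup>-\<^sup>w\<^sup>x x\<^sup>z\<^sup>-\<^sup>1 dx = \<Gamma>(z) w\<^sup>-\<^sup>z\<close> for \<open>Re w > 0\<close>, with \<open>w = \<alpha>\<^sub>n\<^sup>2\<close> and \<open>z = s/2\<close>. This requires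
  \<open>Re (\<alpha>\<^sub>n\<^sup>2) > 0\<close>, i.e. that all zeros in the upper half plane lie in the closed critical strip with
  imaginary part above \<open>1/2\<close>, and the convergence of \<open>\<Sum> |\<alpha>\<^sub>n|\<^sup>-\<^sup>\<sigma>\<close> for \<open>\<sigma> > 1\<close>.

  The trapezoidal rule applied to \<open>\<Sum> n\<^sup>-\<^sup>s\<close> continues \<open>(s - 1) \<zeta>(s)\<close> to \<open>Re s > -1\<close> with a polynomial
  bound and shows that there are no zeros of the strip near the real axis. Jensen's inequality on discs
  of fixed radius then gives \<open>O(log T)\<close> zeros between heights \<open>T\<close> and \<open>T + 1\<close>. The functional equation is
  needed only to continue to the left half plane and to exclude non-real zeros there; for
  \<open>-1 < Re s < 0\<close> it results from evaluating the Mellin transform of \<open>1/(e\<^sup>t - 1) - 1/t + 1/2\<close> in two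
  ways, as a sum over unit intervals and through the partial fractions of the cotangent.
\<close>

section \<open>Integrals over subsets of the line and the Gamma integral\<close>

text \<open>The Riemann Hypothesis is not assumed, so \<open>\<alpha> n\<close> is complex and
  everything rests on \<open>Re ((\<alpha> n)\<^sup>2) = (Im (\<rho> n))\<^sup>2 - (1/2 - Re (\<rho>
  n))\<^sup>2\<close>. In the closed strip the subtracted square is at most 1/4; hence 1/2 is the
  height below which zeros have to be excluded. As the zeros are ordered by height, the lowest one
  yields a single constant \<open>\<kappa> > 0\<close> with \<open>Re ((\<alpha> n)\<^sup>2) \<ge>
  \<kappa> * (Im (\<rho> n))\<^sup>2\<close>, and all convergence questions reduce to the sum of
  \<open>Im (\<rho> n) powr (- \<sigma>)\<close>. \<open>riemann_zeta\<close> is chosen among the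
  continuations to the whole punctured plane, so nothing can be said about it until one has been
  constructed. The trapezoidal rule stops at Re s = -1; its overlap with the left half plane is the
  strip where the functional equation glues both parts. Each interchange of sum and integral is
  dominated in the same way: the norm of an integrand is the same integrand at the real parts of its
  parameters, where the closed formula is already available.\<close>

definition has_set_integral ::
    "(real \<Rightarrow> 'a::{banach, second_countable_topology}) \<Rightarrow> 'a \<Rightarrow> real set \<Rightarrow> bool" where
  "has_set_integral f v A \<longleftrightarrow> set_integrable lborel A f \<and> (LINT x:A|lborel. f x) = v"

text \<open>The integral of a non-integrable function is 0 by convention, so a bare value would
  prove nothing. Bundling it with integrability gives exactly the Bochner notion for the function
  cut off outside \<open>A\<close>, from which the rules below are inherited.\<close>

lemma has_set_integral_iff_has_bochner_integral:
  "has_set_integral f v A \<longleftrightarrow> has_bochner_integral lborel (\<lambda>x. indicator A x *\<^sub>R f x) v"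
  by (simp add: has_set_integral_def has_bochner_integral_iff set_integrable_def
      set_lebesgue_integral_def)

lemma has_set_integral_cong:
  assumes "\<And>x. x \<in> A \<Longrightarrow> f x = g x" and "v = w"
  shows "has_set_integral f v A \<longleftrightarrow> has_set_integral g w A"
proof -
  have "(\<lambda>x. indicator A x *\<^sub>R f x) = (\<lambda>x. indicator A x *\<^sub>R g x)"
    using assms(1) by (intro ext) (auto simp: indicator_def)
  thus ?thesis using assms(2) by (simp add: has_set_integral_iff_has_bochner_integral)
qed

lemma has_set_integral_mult_left:
  fixes f :: "real \<Rightarrow> 'a::{real_normed_field, banach, second_countable_topology}"
  assumes "has_set_integral f v A"
  shows "has_set_integral (\<lambda>x. c * f x) (c * v) A"
  using has_bochner_integral_mult_right[of c lborel "\<lambda>x. indicator A x *\<^sub>R f x" v] assms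
  by (simp add: has_set_integral_iff_has_bochner_integral)

lemma has_set_integral_add:
  assumes "has_set_integral f v A" "has_set_integral g w A"
  shows "has_set_integral (\<lambda>x. f x + g x) (v + w) A"
  using has_bochner_integral_add[OF assms[unfolded has_set_integral_iff_has_bochner_integral]]
  by (simp add: has_set_integral_iff_has_bochner_integral scaleR_add_right)

lemma has_set_integral_Re:
  assumes "has_set_integral f v A"
  shows "has_set_integral (\<lambda>x. Re (f x)) (Re v) A"
  using has_bochner_integral_bounded_linear[OF bounded_linear_Re
      assms[unfolded has_set_integral_iff_has_bochner_integral]]
  by (simp add: has_set_integral_iff_has_bochner_integral)

text \<open>Finiteness of the sum of the integrals of the norms is what allows the interchange. The
  values \<open>u k\<close> of these integrals are named so that every application only has to sum a
  numerical series.\<close>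

lemma has_set_integral_suminf:
  fixes f :: "nat \<Rightarrow> real \<Rightarrow> 'a::{banach, second_countable_topology}"
  assumes f: "\<And>k. has_set_integral (f k) (v k) A"
    and sm: "\<And>x. x \<in> A \<Longrightarrow> summable (\<lambda>k. norm (f k x))"
    and n: "\<And>k. has_set_integral (\<lambda>x. norm (f k x)) (u k) A"
    and u: "summable u"
  shows "has_set_integral (\<lambda>x. \<Sum>k. f k x) (\<Sum>k. v k) A" "summable v"
proof -
  let ?g = "\<lambda>k x. indicator A x *\<^sub>R f k x"
  have ig: "integrable lborel (?g k)" and vg: "integral\<^sup>L lborel (?g k) = v k" for k
    using f[of k] by (simp_all add: has_set_integral_iff_has_bochner_integral has_bochner_integral_iff)
  have ng: "(\<integral>x. norm (?g k x) \<partial>lborel) = u k" for k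
    using n[of k] by (simp add: has_set_integral_iff_has_bochner_integral has_bochner_integral_iff
        indicator_def)
  have sg: "AE x in lborel. summable (\<lambda>k. norm (?g k x))"
    using sm by (intro AE_I2) (auto simp: indicator_def)
  have su: "summable (\<lambda>k. \<integral>x. norm (?g k x) \<partial>lborel)"
    using u by (simp only: ng)
  have eq: "(\<lambda>x. \<Sum>k. ?g k x) = (\<lambda>x. indicator A x *\<^sub>R (\<Sum>k. f k x))"
    by (auto simp: indicator_def)
  show "has_set_integral (\<lambda>x. \<Sum>k. f k x) (\<Sum>k. v k) A"
    using integrable_suminf[OF ig sg su] integral_suminf[OF ig sg su]
    unfolding vg eq by (simp add: has_set_integral_iff_has_bochner_integral has_bochner_integral_iff)
  show "summable v"
    using summable_integral[OF ig sg su] by (simp only: vg)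
qed

text \<open>By Tonelli, the iterated integral of the norm, which is the integral of
  \<open>h\<close>, decides integrability on the product \<open>A \<times> B\<close>. The other
  iterated integral then exists and has the same value.\<close>

lemma has_set_integral_Fubini:
  fixes f :: "real \<Rightarrow> real \<Rightarrow> 'a::{banach, second_countable_topology}"
  assumes [measurable]: "case_prod f \<in> borel_measurable borel" "A \<in> sets borel" "B \<in> sets borel"
    and g: "\<And>x. x \<in> A \<Longrightarrow> has_set_integral (f x) (g x) B"
    and h: "\<And>x. x \<in> A \<Longrightarrow> has_set_integral (\<lambda>y. norm (f x y)) (h x) B"
    and h': "set_integrable lborel A h"
    and k: "\<And>y. y \<in> B \<Longrightarrow> has_set_integral (\<lambda>x. f x y) (k y) A"
    and v: "(LINT x:A|lborel. g x) = v"
  shows "has_set_integral k v B"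
proof -
  let ?F = "\<lambda>p. (indicator A (fst p) * indicator B (snd p)) *\<^sub>R f (fst p) (snd p)"
  have [measurable]: "?F \<in> borel_measurable (lborel \<Otimes>\<^sub>M lborel)"
  proof -
    have "(\<lambda>p. f (fst p) (snd p)) \<in> borel_measurable borel"
      using assms(1) by (simp add: case_prod_beta')
    hence [measurable]: "(\<lambda>p. f (fst p) (snd p)) \<in> borel_measurable (borel \<Otimes>\<^sub>M borel)"
      by (simp add: borel_prod)
    show ?thesis by measurable
  qed
  have i1: "integrable lborel (\<lambda>y. ?F (x, y)) \<and> (\<integral>y. ?F (x, y) \<partial>lborel) = indicator A x *\<^sub>R g x" for x
    using g[of x] by (cases "x \<in> A")
      (auto simp: has_set_integral_iff_has_bochner_integral has_bochner_integral_iff)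
  have i2: "(\<integral>y. norm (?F (x, y)) \<partial>lborel) = indicator A x *\<^sub>R h x" for x
    using h[of x] by (cases "x \<in> A")
      (auto simp: has_set_integral_iff_has_bochner_integral has_bochner_integral_iff indicator_def)
  have i3: "(\<integral>x. ?F (x, y) \<partial>lborel) = indicator B y *\<^sub>R k y" for y
    using k[of y] by (cases "y \<in> B")
      (auto simp: has_set_integral_iff_has_bochner_integral has_bochner_integral_iff)
  have F: "integrable (lborel \<Otimes>\<^sub>M lborel) ?F"
    using i1 h' by (intro lborel_pair.Fubini_integrable)
      (auto simp: i2 set_integrable_def simp del: fst_conv snd_conv norm_scaleR)
  have "integrable lborel (\<lambda>y. \<integral>x. ?F (x, y) \<partial>lborel)"
    using lborel_pair.integrable_snd[of "\<lambda>x y. ?F (x, y)"] F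
    by (simp add: case_prod_beta')
  moreover have "(\<integral>y. (\<integral>x. ?F (x, y) \<partial>lborel) \<partial>lborel) = (\<integral>x. (\<integral>y. ?F (x, y) \<partial>lborel) \<partial>lborel)"
    using lborel_pair.Fubini_integral[of "\<lambda>x y. ?F (x, y)"] F
    by (simp add: case_prod_beta')
  ultimately show ?thesis using i1 v
    unfolding i3 by (simp add: has_set_integral_def set_integrable_def set_lebesgue_integral_def)
qed

section \<open>The Gamma integral with a complex scaling parameter\<close>

lemma has_set_integral_Gamma:
  assumes "Re z > 0"
  shows "has_set_integral (\<lambda>t. of_real t powr (z - 1) * exp (- of_real t)) (Gamma z) {0<..}"
proof -
  let ?f = "\<lambda>t. complex_of_real t powr (z - 1) * exp (- of_real t)"
  have eq: "?f = (\<lambda>t. of_real t powr (z - 1) / of_real (exp t))"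
    by (auto simp: exp_minus exp_of_real divide_inverse)
  have a: "set_integrable lebesgue {0<..} ?f"
    using absolutely_integrable_Gamma_integral'[OF assms] by (simp only: eq)
  have [measurable]: "(\<lambda>x. indicat_real {0<..} x *\<^sub>R ?f x) \<in> borel_measurable lborel"
    by measurable
  have i: "set_integrable lborel {0<..} ?f"
    using a unfolding set_integrable_def by (subst (asm) integrable_completion) auto
  have "(LINT x:{0<..}|lborel. ?f x) = Gamma z"
    using set_borel_integral_eq_integral(2)[OF i] Gamma_integral_complex'[OF assms]
    by (simp add: eq integral_unique)
  with i show ?thesis by (simp add: has_set_integral_def)
qed

lemma has_set_integral_scale:
  fixes f :: "real \<Rightarrow> complex"
  assumes "has_set_integral f v {0<..}" "c > 0"
  shows "has_set_integral (\<lambda>x. f (c * x)) (v / of_real c) {0<..}"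
proof -
  let ?g = "\<lambda>x. indicat_real {0<..} x *\<^sub>R f x"
  have g: "integrable lborel ?g" "integral\<^sup>L lborel ?g = v"
    using assms(1) by (auto simp: has_set_integral_iff_has_bochner_integral has_bochner_integral_iff)
  have eq: "?g (0 + c * x) = indicat_real {0<..} x *\<^sub>R f (c * x)" for x
    using assms(2) by (auto simp: indicator_def zero_less_mult_iff)
  have "integrable lborel (\<lambda>x. ?g (0 + c * x))"
    using assms(2) g by (intro lborel_integrable_real_affine) auto
  moreover have "v = c *\<^sub>R (\<integral>x. ?g (0 + c * x) \<partial>lborel)"
    using lborel_integral_real_affine[of c ?g 0] assms(2) g by simp
  ultimately show ?thesis using assms(2) unfolding eq
    by (simp add: has_set_integral_iff_has_bochner_integral has_bochner_integral_iff scaleR_conv_of_real)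
qed

lemma has_set_integral_Gamma_scaled_real:
  assumes "Re z > 0" "c > 0"
  shows "has_set_integral (\<lambda>t. of_real t powr (z - 1) * exp (- of_real (c * t)))
           (Gamma z * of_real c powr (- z)) {0<..}"
proof -
  have "has_set_integral
          (\<lambda>t. of_real c powr (1 - z) * (of_real (c * t) powr (z - 1) * exp (- of_real (c * t))))
          (of_real c powr (1 - z) * (Gamma z / of_real c)) {0<..}"
    by (intro has_set_integral_mult_left has_set_integral_scale[OF has_set_integral_Gamma] assms)
  also have "?this \<longleftrightarrow> ?thesis"
  proof (rule has_set_integral_cong)
    fix t :: real assume "t \<in> {0<..}"
    hence "complex_of_real (c * t) powr (z - 1) = of_real c powr (z - 1) * of_real t powr (z - 1)"
      using assms by (simp add: powr_times_real_left)
    moreover have "complex_of_real c powr (1 - z) * of_real c powr (z - 1) = 1"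
      using assms by (simp flip: powr_add)
    ultimately show "of_real c powr (1 - z) * (of_real (c * t) powr (z - 1) * exp (- of_real (c * t)))
        = of_real t powr (z - 1) * exp (- complex_of_real (c * t))"
      by (simp add: mult_ac)
  next
    show "of_real c powr (1 - z) * (Gamma z / of_real c) = Gamma z * of_real c powr (- z)"
      using assms by (simp add: powr_diff powr_minus field_simps)
  qed
  finally show ?thesis .
qed

lemma norm_of_real_powr:
  "x > 0 \<Longrightarrow> norm (complex_of_real x powr z) = x powr Re z"
  by (simp add: norm_powr_real_powr)

text \<open>The norm of the complex integrand is the integrand with exponent \<open>Re z\<close>, so
  the real case supplies the dominating integrals.\<close>

lemma has_set_integral_norm_Gamma_scaled:
  assumes "Re z > 0" "c > 0"
  shows "has_set_integral (\<lambda>t. t powr (Re z - 1) * exp (- (c * t)))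
           (Gamma (Re z) * c powr (- Re z)) {0<..}"
proof -
  have "has_set_integral (\<lambda>t. Re (of_real t powr (of_real (Re z) - 1) * exp (- of_real (c * t))))
           (Re (Gamma (of_real (Re z)) * of_real c powr (- of_real (Re z)))) {0<..}"
    using assms by (intro has_set_integral_Re has_set_integral_Gamma_scaled_real) auto
  also have "?this \<longleftrightarrow> ?thesis"
  proof (rule has_set_integral_cong)
    fix t :: real assume "t \<in> {0<..}"
    hence "complex_of_real t powr (of_real (Re z) - 1) * exp (- of_real (c * t))
        = of_real (t powr (Re z - 1) * exp (- (c * t)))"
      by (simp add: powr_of_real[symmetric] exp_of_real[symmetric])
    thus "Re (of_real t powr (of_real (Re z) - 1) * exp (- of_real (c * t)))
        = t powr (Re z - 1) * exp (- (c * t))"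
      by (metis Re_complex_of_real)
  next
    have "Gamma (of_real (Re z)) * of_real c powr (- of_real (Re z))
        = complex_of_real (Gamma (Re z) * c powr (- Re z))"
      using assms by (simp add: powr_of_real[symmetric] Gamma_complex_of_real)
    thus "Re (Gamma (of_real (Re z)) * of_real c powr (- of_real (Re z))) = Gamma (Re z) * c powr (- Re z)"
      by (metis Re_complex_of_real)
  qed
  finally show ?thesis .
qed

text \<open>For complex \<open>w\<close> choose a real \<open>L\<close> with \<open>|L - w| < L\<close>, expand \<open>exp ((L - w) t)\<close> and sum the
  resulting Gamma integrals by the binomial series.\<close>
theorem has_set_integral_Gamma_scaled:
  assumes z: "Re z > 0" and w: "Re w > 0"
  shows "has_set_integral (\<lambda>t. of_real t powr (z - 1) * exp (- (w * of_real t)))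
           (Gamma z * w powr (- z)) {0<..}"
proof -
  \<comment> \<open>The square of \<open>|L - w|\<close> is \<open>L^2 - 2 L Re w + |w|^2\<close>,
    which is below \<open>L^2\<close> exactly when \<open>L\<close> exceeds
    \<open>|w|^2 / (2 Re w)\<close>; \<open>L\<close> is twice this threshold.\<close>
  define L where "L = (cmod w)\<^sup>2 / Re w"
  \<comment> \<open>Now \<open>w = L (1 - y)\<close> with \<open>|y| < 1\<close>, so the binomial
    series of \<open>(1 - y) powr (- z)\<close> produces \<open>w powr (- z)\<close>.\<close>
  define y where "y = (of_real L - w) / of_real L"
  have L: "L > 0" using w by (auto simp: L_def intro!: divide_pos_pos)
  have "(cmod (of_real L - w))\<^sup>2 = L\<^sup>2 - 2 * L * Re w + (cmod w)\<^sup>2"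
    unfolding cmod_power2 by (simp add: power2_eq_square algebra_simps)
  also have "2 * L * Re w = 2 * (cmod w)\<^sup>2"
    using w by (simp add: L_def)
  finally have "(cmod (of_real L - w))\<^sup>2 < L\<^sup>2"
    using w by auto
  hence nw: "cmod (of_real L - w) < L"
    using L by (simp add: power2_less_imp_less)
  have y: "cmod y < 1"
    using L nw by (simp add: y_def norm_divide)
  let ?f = "\<lambda>k t. (of_real L - w) ^ k / fact k *
      (of_real t powr (z + of_nat k - 1) * exp (- complex_of_real (L * t)))"
  define v where "v = (\<lambda>k. (of_real L - w) ^ k / fact k *
      (Gamma (z + of_nat k) * of_real L powr (- (z + of_nat k))))"
  define u where "u = (\<lambda>k. cmod (of_real L - w) ^ k / fact k *
      (Gamma (Re (z + of_nat k)) * L powr (- Re (z + of_nat k))))"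
  have f: "has_set_integral (?f k) (v k) {0<..}" for k
    unfolding v_def using z L
    by (intro has_set_integral_mult_left has_set_integral_Gamma_scaled_real) auto
  have nf: "norm (?f k t) = cmod (of_real L - w) ^ k / fact k *
      (t powr (Re (z + of_nat k) - 1) * exp (- (L * t)))" if "t > 0" for k t
    using that by (simp add: norm_mult norm_divide norm_power norm_of_real_powr)
  have "has_set_integral (\<lambda>t. cmod (of_real L - w) ^ k / fact k *
      (t powr (Re (z + of_nat k) - 1) * exp (- (L * t)))) (u k) {0<..}" for k
    unfolding u_def using z L
    by (intro has_set_integral_mult_left has_set_integral_norm_Gamma_scaled) auto
  hence n: "has_set_integral (\<lambda>t. norm (?f k t)) (u k) {0<..}" for k
    by (subst has_set_integral_cong[OF nf refl]) auto
  have pk: "of_real t powr (z + of_nat k - 1) = of_real t powr (z - 1) * of_real t ^ k"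
    if "t > 0" for t k
    using that powr_add[of "complex_of_real t" "z - 1" "of_nat k"]
    by (simp add: powr_nat algebra_simps)
  have fe: "?f k t = of_real t powr (z - 1) * exp (- of_real (L * t)) *
      (((of_real L - w) * of_real t) ^ k / fact k)" if "t > 0" for k t
    using pk[OF that, of k] by (simp add: power_mult_distrib)
  have expw: "(\<lambda>k. x ^ k / fact k) sums exp x" for x :: complex
    using exp_converges[of x] by (simp add: divide_inverse mult.commute scaleR_conv_of_real)
  have sf: "(\<Sum>k. ?f k t) = of_real t powr (z - 1) * exp (- (w * of_real t))" if "t > 0" for t
  proof -
    have "(\<lambda>k. ?f k t) sums (of_real t powr (z - 1) * exp (- of_real (L * t)) *
        exp ((of_real L - w) * of_real t))"
      unfolding fe[OF that] by (intro sums_mult expw)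
    also have "of_real t powr (z - 1) * exp (- of_real (L * t)) * exp ((of_real L - w) * of_real t)
        = of_real t powr (z - 1) * exp (- (w * of_real t))"
      by (simp add: mult.assoc algebra_simps flip: exp_add)
    finally show ?thesis by (rule sums_unique[symmetric])
  qed
  have smf: "summable (\<lambda>k. norm (?f k t))" if "t \<in> {0<..}" for t
  proof -
    have "summable (\<lambda>k. norm (x ^ k / fact k))" for x :: complex
      using summable_norm_exp[of x] by (simp add: divide_inverse mult.commute norm_mult norm_inverse)
    thus ?thesis
      using that unfolding fe[OF that[unfolded greaterThan_iff]] norm_mult[of "_ * _" "_ / _"]
      by (intro summable_mult) auto
  qed
  \<comment> \<open>The norms form the same binomial series with exponent \<open>- Re z\<close> at
    \<open>- cmod y\<close>, where all terms are nonnegative.\<close>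
  have u: "summable u"
  proof -
    have "(\<lambda>k. ((- Re z) gchoose k) * (- cmod y) ^ k) sums (1 + - cmod y) powr (- Re z)"
      using y by (intro gen_binomial_real) auto
    hence "summable (\<lambda>k. Gamma (Re z) * L powr (- Re z) * (((- Re z) gchoose k) * (- cmod y) ^ k))"
      by (intro summable_mult) (auto simp: sums_iff)
    also have "(\<lambda>k. Gamma (Re z) * L powr (- Re z) * (((- Re z) gchoose k) * (- cmod y) ^ k)) = u"
    proof
      fix k
      have "Re z \<notin> \<int>\<^sub>\<le>\<^sub>0" using z by (auto elim!: nonpos_Ints_cases)
      hence pg: "pochhammer (Re z) k * Gamma (Re z) = Gamma (Re z + of_nat k)"
        using z by (subst pochhammer_Gamma) (auto simp: Gamma_eq_zero_iff)
      moreover have "L powr (- (Re z + real k)) = L powr (- Re z) / L ^ k"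
        using L by (simp add: powr_diff powr_realpow)
      moreover have "cmod y ^ k = cmod (of_real L - w) ^ k / L ^ k"
        using L by (simp add: y_def norm_divide power_divide)
      moreover have "((- Re z) gchoose k) * (- cmod y) ^ k = pochhammer (Re z) k / fact k * cmod y ^ k"
        by (simp add: gbinomial_pochhammer power_minus[of "cmod y"])
      ultimately show "Gamma (Re z) * L powr (- Re z) * (((- Re z) gchoose k) * (- cmod y) ^ k) = u k"
        by (simp add: u_def mult_ac flip: pg)
    qed
    finally show ?thesis .
  qed
  have v: "(\<Sum>k. v k) = Gamma z * w powr (- z)"
  proof -
    have "(\<lambda>k. ((- z) gchoose k) * (- y) ^ k) sums (1 + - y) powr (- z)"
      using y by (intro gen_binomial_complex) auto
    hence "(\<lambda>k. Gamma z * of_real L powr (- z) * (((- z) gchoose k) * (- y) ^ k)) sums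
        (Gamma z * of_real L powr (- z) * (1 + - y) powr (- z))"
      by (intro sums_mult)
    also have "(\<lambda>k. Gamma z * of_real L powr (- z) * (((- z) gchoose k) * (- y) ^ k)) = v"
    proof
      fix k
      have "z \<notin> \<int>\<^sub>\<le>\<^sub>0" using z by (auto elim!: nonpos_Ints_cases)
      hence pg: "pochhammer z k * Gamma z = Gamma (z + of_nat k)"
        by (subst pochhammer_Gamma) (auto simp: Gamma_eq_zero_iff)
      moreover have "of_real L powr (- (z + of_nat k)) = complex_of_real L powr (- z) / of_real L ^ k"
        using L powr_diff[of "complex_of_real L" "-z" "of_nat k"] by (simp add: powr_nat)
      moreover have "y ^ k = (of_real L - w) ^ k / of_real L ^ k"
        by (simp add: y_def power_divide)
      moreover have "((- z) gchoose k) * (- y) ^ k = pochhammer z k / fact k * y ^ k"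
        by (simp add: gbinomial_pochhammer power_minus[of y])
      ultimately show "Gamma z * of_real L powr (- z) * (((- z) gchoose k) * (- y) ^ k) = v k"
        by (simp add: v_def mult_ac flip: pg)
    qed
    also have "1 + - y = w / of_real L"
      using L by (simp add: y_def field_simps)
    also have "Gamma z * of_real L powr (- z) * (w / of_real L) powr (- z) = Gamma z * w powr (- z)"
      using L powr_times_real_left[of "complex_of_real L" "w / of_real L" "-z"] by simp
    finally show ?thesis by (rule sums_unique[symmetric])
  qed
  have "has_set_integral (\<lambda>t. \<Sum>k. ?f k t) (\<Sum>k. v k) {0<..}"
    by (rule has_set_integral_suminf(1)[OF f smf n u]) auto
  also have "?this \<longleftrightarrow> ?thesis"
    by (intro has_set_integral_cong sf v) auto
  finally show ?thesis .
qed

section \<open>Continuation by the trapezoidal rule\<close>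

definition dirichlet_zeta :: "complex \<Rightarrow> complex" where
  "dirichlet_zeta s = (\<Sum>n. of_nat (Suc n) powr (- s))"

text \<open>The second summand is \<open>1 - s\<close> times the integral of x^(-s) over [n, n + 1].
  Multiplying by \<open>s - 1\<close> clears the pole of that integral's closed form at s =
  1.\<close>

definition trapezoid_term :: "nat \<Rightarrow> complex \<Rightarrow> complex" where
  "trapezoid_term n s = (s - 1) * (of_nat n powr (- s) + of_nat (Suc n) powr (- s)) / 2 +
     (of_nat (Suc n) powr (1 - s) - of_nat n powr (1 - s))"

text \<open>Up to the factor \<open>s - 1\<close>, the \<open>n\<close>-th term is the error of the trapezoidal rule for
  \<open>x\<^sup>-\<^sup>s\<close> on \<open>[n, n + 1]\<close>; the sum below is \<open>(s - 1) \<zeta>(s)\<close>.\<close>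
definition zeta_numerator :: "complex \<Rightarrow> complex" where
  "zeta_numerator s = (s + 1) / 2 + (\<Sum>n. trapezoid_term (Suc n) s)"

text \<open>Two integrations by parts: the kernel q(x) = (x - n)(n + 1 - x)/2 vanishes at both ends
  and has second derivative -1, while x^(-s) has second derivative s(s + 1) x^(-s-2). The decay
  n^(-Re s - 2) is what makes the series converge for Re s > -1.\<close>

lemma has_integral_trapezoid_kernel:
  assumes "n > 0"
  shows "((\<lambda>x. (s - 1) * s * (s + 1) *
            (of_real ((x - real n) * (real n + 1 - x) / 2) * of_real x powr (- s - 2)))
          has_integral trapezoid_term n s) {real n..real n + 1}"
proof -
  \<comment> \<open>With f(x) = x^(-s), this is s - 1 times \<open>q f' - q' f\<close> minus an
    antiderivative of f.\<close>
  define P where "P = (\<lambda>z. (s - 1) * (- s * ((z - of_nat n) * (of_nat n + 1 - z) / 2) * z powr (- s - 1)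
     - (of_nat n + 1 / 2 - z) * z powr (- s)) + z powr (1 - s))"
  have "((\<lambda>x. (s - 1) * s * (s + 1) *
            (of_real ((x - real n) * (real n + 1 - x) / 2) * of_real x powr (- s - 2)))
          has_integral P (of_real (real n + 1)) - P (of_real (real n))) {real n..real n + 1}"
  proof (rule fundamental_theorem_of_calculus)
    fix x assume x: "x \<in> {real n..real n + 1}"
    hence "complex_of_real x \<notin> \<real>\<^sub>\<le>\<^sub>0" using assms by (simp add: complex_nonpos_Reals_iff)
    hence D: "((\<lambda>z. z powr c) has_field_derivative c * of_real x powr (c - 1)) (at (of_real x))"
      for c :: complex
      by (rule has_field_derivative_powr)
    have e: "- s - 1 - 1 = - s - 2" "1 - s - 1 = - s" by auto
    have Q: "((\<lambda>z. (z - of_nat n) * (of_nat n + 1 - z) / 2) has_field_derivative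
        (of_nat n + 1 / 2 - of_real x)) (at (complex_of_real x))"
      by (auto intro!: derivative_eq_intros simp: field_simps)
    have R: "((\<lambda>z. of_nat n + 1 / 2 - z) has_field_derivative - 1) (at (complex_of_real x))"
      by (auto intro!: derivative_eq_intros)
    have "(P has_field_derivative (s - 1) * s * (s + 1) *
            (of_real ((x - real n) * (real n + 1 - x) / 2) * of_real x powr (- s - 2))) (at (of_real x))"
      unfolding P_def
      by (rule DERIV_cong[OF DERIV_add[OF DERIV_cmult[OF DERIV_diff[OF
            DERIV_mult[OF DERIV_cmult[OF Q] D] DERIV_mult[OF R D]]] D]])
         (simp add: e, simp add: field_simps)
    thus "((\<lambda>x. P (of_real x)) has_vector_derivative (s - 1) * s * (s + 1) *
            (of_real ((x - real n) * (real n + 1 - x) / 2) * of_real x powr (- s - 2)))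
          (at x within {real n..real n + 1})"
      by (rule has_vector_derivative_real_field)
  qed auto
  also have "P (of_real (real n + 1)) - P (of_real (real n)) = trapezoid_term n s"
    by (simp add: P_def trapezoid_term_def add.commute field_simps)
  finally show ?thesis .
qed

lemma trapezoid_kernel_bounds:
  fixes a x :: real
  assumes "x \<in> {a..a + 1}"
  shows "0 \<le> (x - a) * (a + 1 - x) / 2" "(x - a) * (a + 1 - x) / 2 \<le> 1 / 8"
proof -
  show "0 \<le> (x - a) * (a + 1 - x) / 2" using assms by auto
  have "0 \<le> (x - a - 1 / 2) ^ 2" by simp
  thus "(x - a) * (a + 1 - x) / 2 \<le> 1 / 8" by (simp add: power2_eq_square field_simps)
qed

lemma norm_trapezoid_term_le:
  assumes "n > 0" "Re s \<ge> c" "c > -1"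
  shows "norm (trapezoid_term n s) \<le>
    norm ((s - 1) * s * (s + 1)) / 8 * real n powr (- (c + 2))"
proof -
  have "norm (trapezoid_term n s) \<le> norm ((s - 1) * s * (s + 1)) * (1 / 8 * real n powr (- (c + 2))) *
      measure lborel (cbox (real n) (real n + 1))"
  proof (rule has_integral_bound)
    show "((\<lambda>x. (s - 1) * s * (s + 1) *
            (of_real ((x - real n) * (real n + 1 - x) / 2) * of_real x powr (- s - 2)))
          has_integral trapezoid_term n s) (cbox (real n) (real n + 1))"
      using has_integral_trapezoid_kernel[OF assms(1), of s] by simp
    fix x assume "x \<in> cbox (real n) (real n + 1)"
    hence x: "x \<in> {real n..real n + 1}" by simp
    hence x1: "x \<ge> 1" "x \<ge> n" using assms by auto
    have "norm (of_real x powr (- s - 2)) = x powr (- Re s - 2)"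
      using x1 by (simp add: norm_powr_real_powr)
    also have "\<dots> \<le> x powr (- (c + 2))"
      using x1 assms by (intro powr_mono) auto
    also have "\<dots> \<le> real n powr (- (c + 2))"
      using x1 assms by (intro powr_mono2') auto
    finally have "norm (of_real ((x - real n) * (real n + 1 - x) / 2) * of_real x powr (- s - 2))
        \<le> 1 / 8 * real n powr (- (c + 2))"
      using trapezoid_kernel_bounds[OF x] unfolding norm_mult norm_of_real
      by (intro mult_mono) auto
    thus "norm ((s - 1) * s * (s + 1) *
        (of_real ((x - real n) * (real n + 1 - x) / 2) * of_real x powr (- s - 2)))
        \<le> norm ((s - 1) * s * (s + 1)) * (1 / 8 * real n powr (- (c + 2)))"
      unfolding norm_mult[of "(s - 1) * s * (s + 1)"] by (intro mult_left_mono) auto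
  qed auto
  thus ?thesis by simp
qed

lemma summable_Suc_powr: "c > -1 \<Longrightarrow> summable (\<lambda>n. real (Suc n) powr (- (c + 2)))"
  using summable_real_powr_iff[of "- (c + 2)"]
  by (subst summable_Suc_iff) simp

text \<open>The constant is kept explicit because the bound is used twice: with \<open>c = 0\<close>
  it excludes zeros near the real axis, with \<open>c = - 1 / 2\<close> it gives cubic growth for
  Jensen's inequality.\<close>

lemma norm_zeta_numerator_diff_le:
  assumes "Re s \<ge> c" "c > -1"
  shows "summable (\<lambda>n. trapezoid_term (Suc n) s)"
    and "norm (zeta_numerator s - (s + 1) / 2) \<le>
      norm ((s - 1) * s * (s + 1)) / 8 * (\<Sum>n. real (Suc n) powr (- (c + 2)))"
proof -
  let ?M = "\<lambda>n. norm ((s - 1) * s * (s + 1)) / 8 * real (Suc n) powr (- (c + 2))"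
  have b: "norm (trapezoid_term (Suc n) s) \<le> ?M n" for n
    using norm_trapezoid_term_le[of "Suc n" c s] assms by simp
  have sm: "summable ?M" by (intro summable_mult summable_Suc_powr assms)
  have n: "summable (\<lambda>n. norm (trapezoid_term (Suc n) s))"
    by (rule summable_comparison_test'[OF sm, of 0]) (use b in auto)
  thus "summable (\<lambda>n. trapezoid_term (Suc n) s)" by (rule summable_norm_cancel)
  have "norm (zeta_numerator s - (s + 1) / 2) \<le> (\<Sum>n. norm (trapezoid_term (Suc n) s))"
    using summable_norm[OF n] by (simp add: zeta_numerator_def)
  also have "\<dots> \<le> suminf ?M" by (intro suminf_le b n sm)
  also have "\<dots> = norm ((s - 1) * s * (s + 1)) / 8 * (\<Sum>n. real (Suc n) powr (- (c + 2)))"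
    by (intro suminf_mult summable_Suc_powr assms)
  finally show "norm (zeta_numerator s - (s + 1) / 2) \<le>
      norm ((s - 1) * s * (s + 1)) / 8 * (\<Sum>n. real (Suc n) powr (- (c + 2)))" .
qed

lemma holomorphic_zeta_numerator: "zeta_numerator holomorphic_on {s. Re s > -1}"
proof -
  have "(\<lambda>s. \<Sum>n. trapezoid_term (Suc n) s) holomorphic_on {s. Re s > -1}"
  proof (rule holomorphic_uniform_sequence)
    show "(\<lambda>s. \<Sum>i<N. trapezoid_term (Suc i) s) holomorphic_on {s. Re s > -1}" for N
      unfolding trapezoid_term_def by (intro holomorphic_intros) auto
    show "open {s. Re s > -1}" by (rule open_halfspace_Re_gt)
  next
    fix x assume "x \<in> {s. Re s > -1}"
    hence x: "Re x > -1" by simp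
    \<comment> \<open>Half the distance to the line Re = -1, so that the whole closed disc stays to
      its right and one convergent majorant serves all of it.\<close>
    define d where "d = (Re x + 1) / 2"
    define K where "K = (norm x + d + 1) * (norm x + d) * (norm x + d + 1) / 8"
    have d: "d > 0" using x by (simp add: d_def)
    have *: "Re s \<ge> Re x - d \<and> norm s \<le> norm x + d" if "s \<in> cball x d" for s
    proof -
      have "norm (x - s) \<le> d" using that by (simp add: dist_norm)
      moreover have "Re x - Re s \<le> norm (x - s)" using complex_Re_le_cmod[of "x - s"] by simp
      moreover have "norm s \<le> norm x + norm (x - s)"
        by (metis norm_minus_commute norm_triangle_sub)
      ultimately show ?thesis by simp
    qed
    have c: "Re x - d > -1" using x by (simp add: d_def field_simps)
    have "uniform_limit (cball x d) (\<lambda>N s. \<Sum>i<N. trapezoid_term (Suc i) s)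
        (\<lambda>s. \<Sum>n. trapezoid_term (Suc n) s) sequentially"
    proof (rule Weierstrass_m_test)
      fix n s assume s: "s \<in> cball x d"
      have "norm (trapezoid_term (Suc n) s) \<le>
          norm ((s - 1) * s * (s + 1)) / 8 * real (Suc n) powr (- (Re x - d + 2))"
        using norm_trapezoid_term_le[of "Suc n" "Re x - d" s] *[OF s] c by simp
      also have "norm ((s - 1) * s * (s + 1)) / 8 \<le> K"
        unfolding norm_mult K_def using *[OF s] d
          norm_triangle_ineq4[of s 1] norm_triangle_ineq[of s 1]
        by (intro divide_right_mono mult_mono mult_nonneg_nonneg) auto
      hence "norm ((s - 1) * s * (s + 1)) / 8 * real (Suc n) powr (- (Re x - d + 2))
          \<le> K * real (Suc n) powr (- (Re x - d + 2))"
        by (intro mult_right_mono) auto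
      finally show "norm (trapezoid_term (Suc n) s) \<le> K * real (Suc n) powr (- (Re x - d + 2))" .
    next
      show "summable (\<lambda>n. K * real (Suc n) powr (- (Re x - d + 2)))"
        by (intro summable_mult summable_Suc_powr c)
    qed
    moreover have "cball x d \<subseteq> {s. Re s > -1}"
      using * c by force
    ultimately show "\<exists>d>0. cball x d \<subseteq> {s. Re s > -1} \<and>
        uniform_limit (cball x d) (\<lambda>N s. \<Sum>i<N. trapezoid_term (Suc i) s)
        (\<lambda>s. \<Sum>n. trapezoid_term (Suc n) s) sequentially"
      using d by blast
  qed
  thus ?thesis unfolding zeta_numerator_def[abs_def]
    by (intro holomorphic_intros) auto
qed

lemma summable_dirichlet_zeta:
  assumes "Re s > 1"
  shows "summable (\<lambda>n. norm (of_nat (Suc n) powr (- s)))"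
proof -
  have "(\<lambda>n. norm (of_nat (Suc n) powr (- s))) = (\<lambda>n. real (Suc n) powr (- (Re s - 2 + 2)))"
    using norm_powr_real_powr[of "of_nat (Suc _)" "- s"] by (simp del: of_nat_Suc)
  thus ?thesis using summable_Suc_powr[of "Re s - 2"] assms by simp
qed

text \<open>In the averages every integer from 2 on is met twice with weight 1/2, but 1 only once,
  and the integrals telescope to -1. The deficit \<open>(s - 1) / 2 + 1\<close> is the term
  \<open>(s + 1) / 2\<close> of the definition.\<close>

lemma zeta_numerator_eq_dirichlet:
  assumes "Re s > 1"
  shows "zeta_numerator s = (s - 1) * dirichlet_zeta s"
proof -
  let ?a = "\<lambda>n. of_nat (Suc n) powr (- s)"
  have a: "?a sums dirichlet_zeta s"
    using summable_norm_cancel[OF summable_dirichlet_zeta[OF assms]]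
    by (simp add: dirichlet_zeta_def sums_iff)
  have b: "(\<lambda>n. ?a (Suc n)) sums (dirichlet_zeta s - 1)"
    using a by (subst sums_Suc_iff) simp
  have "(\<lambda>n. of_nat (Suc n) powr (- (s - 1))) \<longlonglongrightarrow> (0 :: complex)"
    using assms by (intro tendsto_neg_powr_complex_of_nat filterlim_Suc) auto
  hence "(\<lambda>n. of_nat (Suc (Suc n)) powr (- (s - 1)) - of_nat (Suc n) powr (- (s - 1))) sums
      (0 - of_nat (Suc 0) powr (- (s - 1)))"
    by (rule telescope_sums)
  hence t: "(\<lambda>n. of_nat (Suc (Suc n)) powr (1 - s) - of_nat (Suc n) powr (1 - s)) sums (- 1)"
    by simp
  have "(\<lambda>n. (s - 1) / 2 * (?a n + ?a (Suc n)) +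
      (of_nat (Suc (Suc n)) powr (1 - s) - of_nat (Suc n) powr (1 - s))) sums
      ((s - 1) / 2 * (dirichlet_zeta s + (dirichlet_zeta s - 1)) + (- 1))"
    by (intro sums_add sums_mult a b t)
  hence "(\<lambda>n. trapezoid_term (Suc n) s) sums
      ((s - 1) / 2 * (dirichlet_zeta s + (dirichlet_zeta s - 1)) + (- 1))"
    by (simp add: trapezoid_term_def)
  thus ?thesis by (simp add: zeta_numerator_def sums_iff field_simps)
qed

section \<open>Zero-free regions near the critical segment and for Re s > 1\<close>

lemma zeta_numerator_nonzero_near_real_axis:
  assumes "0 \<le> Re s" "Re s \<le> 1" "\<bar>Im s\<bar> \<le> 1 / 2"
  shows "zeta_numerator s \<noteq> 0"
proof
  assume "zeta_numerator s = 0"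
  hence "norm ((s + 1) / 2) \<le>
      norm ((s - 1) * s * (s + 1)) / 8 * (\<Sum>n. real (Suc n) powr (- (0 + 2)))"
    using norm_zeta_numerator_diff_le(2)[of 0 s] assms by (simp add: norm_minus_commute)
  also have "(\<lambda>n. real (Suc n) powr (- (0 + 2))) = (\<lambda>n. 1 / (real n + 1)\<^sup>2)"
    by (auto simp: powr_minus divide_inverse add.commute)
  also have "(\<Sum>n. 1 / (real n + 1)\<^sup>2) = pi\<^sup>2 / 6"
    using inverse_squares_sums by (simp add: sums_iff add.commute)
  \<comment> \<open>A zero would require the remainder to be as large as the leading term
    \<open>(s + 1) / 2\<close>. It is not, since \<open>|s (s - 1)| \<le> 2\<close> on the rectangle
    and \<open>pi\<^sup>2 / 6 < 2\<close>.\<close>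
  finally have le: "norm (s + 1) * 4 \<le> norm (s + 1) * (norm (s - 1) * norm s * (pi\<^sup>2 / 6))"
    unfolding norm_mult norm_divide by (simp add: mult_ac)
  have "Re (s + 1) > 0" using assms by simp
  hence "norm (s + 1) > 0" using complex_Re_le_cmod[of "s + 1"] by linarith
  hence le: "4 \<le> norm (s - 1) * norm s * (pi\<^sup>2 / 6)"
    using le by (subst (asm) mult_le_cancel_left_pos) auto
  have im: "(Im s)\<^sup>2 \<le> 1" using assms by (simp add: abs_square_le_1)
  have "(Re s)\<^sup>2 \<le> 1" using assms by (simp add: abs_square_le_1)
  hence "(norm s)\<^sup>2 \<le> 2" using im by (simp add: cmod_power2)
  moreover have "(norm (s - 1))\<^sup>2 \<le> 2"
  proof -
    have "(Re s - 1)\<^sup>2 \<le> 1" using assms by (simp add: abs_square_le_1)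
    thus ?thesis using im by (simp add: cmod_power2)
  qed
  ultimately have "(norm (s - 1) * norm s)\<^sup>2 \<le> 2\<^sup>2"
    unfolding power_mult_distrib using mult_mono[of "(norm (s - 1))\<^sup>2" 2 "(norm s)\<^sup>2" 2] by simp
  hence "norm (s - 1) * norm s \<le> 2" by (rule power2_le_imp_le) simp
  moreover have "pi\<^sup>2 / 6 < 2"
  proof -
    have "pi < 3.2" using pi_approx by simp
    hence "pi\<^sup>2 < 3.2\<^sup>2" by (intro power_strict_mono) auto
    thus ?thesis by (simp add: power2_eq_square)
  qed
  ultimately have "norm (s - 1) * norm s * (pi\<^sup>2 / 6) \<le> 2 * (pi\<^sup>2 / 6)" "2 * (pi\<^sup>2 / 6) < 4"
    using mult_right_mono[of "norm (s - 1) * norm s" 2 "pi\<^sup>2 / 6"] by auto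
  with le show False by linarith
qed

text \<open>Sieving out the multiples of successive primes, a zero of the series would force the
  sum over the integers without prime factors up to \<open>N\<close> to vanish for every \<open>N\<close>, although it is
  \<open>1\<close> plus a tail of the series.\<close>
lemma dirichlet_zeta_nonzero:
  assumes "Re s > 1"
  shows "dirichlet_zeta s \<noteq> 0"
proof
  assume zero: "dirichlet_zeta s = 0"
  define f where "f = (\<lambda>n. complex_of_nat n powr (- s))"
  define A where "A = (\<lambda>N. {n::nat. n > 0 \<and> (\<forall>p\<le>N. prime p \<longrightarrow> \<not> p dvd n)})"
  have sm: "summable (\<lambda>n. norm (f n))"
    using summable_dirichlet_zeta[OF assms] unfolding f_def
    by (subst (asm) summable_Suc_iff)
  have abs: "(\<lambda>n. norm (f n)) summable_on X" for X
    by (rule summable_on_subset_banach[of _ UNIV])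
       (use sm in \<open>auto intro: norm_summable_imp_summable_on\<close>)
  have so: "f summable_on X" for X
    by (rule abs_summable_summable[OF abs])
  have "infsum f (A N) = 0" for N
  proof (induction N)
    case 0
    have A0: "A 0 = Suc ` UNIV"
      using greaterThan_0 by (auto simp: A_def)
    have "infsum f (A 0) = infsum (\<lambda>n. f (Suc n)) UNIV"
      unfolding A0 by (subst infsum_reindex) (auto simp: o_def)
    also have "\<dots> = dirichlet_zeta s"
      using summable_dirichlet_zeta[OF assms] summable_norm_cancel[OF summable_dirichlet_zeta[OF assms]]
      unfolding dirichlet_zeta_def f_def
      by (intro infsumI norm_summable_imp_has_sum summable_sums)
    finally show ?case using zero by simp
  next
    case (Suc N)
    show ?case
    proof (cases "prime (Suc N)")
      case False
      hence "A (Suc N) = A N" by (auto simp: A_def le_Suc_eq)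
      thus ?thesis using Suc by simp
    next
      case True
      let ?p = "Suc N"
      \<comment> \<open>Members divisible by the new prime are that prime times arbitrary members of
        \<open>A N\<close>, as no smaller prime divides it. By multiplicativity of \<open>f\<close>
        they contribute a multiple of the sum over \<open>A N\<close>, hence 0, and removing them
        keeps the sum zero.\<close>
      have split: "A N = A ?p \<union> (*) ?p ` A N"
      proof (intro equalityI subsetI)
        fix n assume n: "n \<in> A N"
        show "n \<in> A ?p \<union> (*) ?p ` A N"
        proof (cases "?p dvd n")
          case True
          then obtain m where m: "n = ?p * m" by (elim dvdE)
          hence "m \<in> A N" using n by (auto simp: A_def intro: dvd_mult simp del: mult_Suc)
          thus ?thesis using m by blast
        next
          case False
          thus ?thesis using n by (auto simp: A_def le_Suc_eq)
        qed
      next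
        fix n assume "n \<in> A ?p \<union> (*) ?p ` A N"
        thus "n \<in> A N"
        proof
          assume "n \<in> A ?p" thus ?thesis by (auto simp: A_def)
        next
          assume "n \<in> (*) ?p ` A N"
          then obtain m where m: "n = ?p * m" "m \<in> A N" by blast
          have "\<not> q dvd n" if q: "prime q" "q \<le> N" for q
          proof
            assume "q dvd n"
            hence "q dvd ?p \<or> q dvd m" using q m by (simp add: prime_dvd_mult_iff del: mult_Suc)
            moreover have "\<not> q dvd m" using m q by (auto simp: A_def)
            moreover have "\<not> q dvd ?p" using q primes_dvd_imp_eq[OF q(1) True] by auto
            ultimately show False by blast
          qed
          thus ?thesis using m by (auto simp: A_def)
        qed
      qed
      have disj: "A ?p \<inter> (*) ?p ` A N = {}"
        using True by (auto simp: A_def simp del: mult_Suc)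
      have "infsum f ((*) ?p ` A N) = infsum (\<lambda>n. f (?p * n)) (A N)"
        by (subst infsum_reindex) (auto simp: o_def inj_on_def simp del: mult_Suc)
      also have "(\<lambda>n. f (?p * n)) = (\<lambda>n. f ?p * f n)"
        by (rule ext, unfold f_def of_nat_mult, rule powr_times_real_left) auto
      also have "infsum (\<lambda>n. f ?p * f n) (A N) = f ?p * infsum f (A N)"
        by (intro infsum_cmult_right so)
      finally have "infsum f ((*) ?p ` A N) = 0" using Suc by simp
      moreover have "infsum f (A N) = infsum f (A ?p) + infsum f ((*) ?p ` A N)"
        using split infsum_Un_disjoint[OF so so disj] by simp
      ultimately show ?thesis using Suc by simp
    qed
  qed
  \<comment> \<open>Every member of \<open>A N\<close> except 1 has a prime factor above
    \<open>N\<close> and so exceeds \<open>N\<close>; a tail of norm less than 1 cannot cancel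
    \<open>f 1 = 1\<close>.\<close>
  obtain N where N: "norm (\<Sum>n. norm (f (n + N))) < 1"
    using suminf_exist_split[OF zero_less_one sm] by blast
  define B where "B = A N - {1}"
  have one: "1 \<in> A N" by (auto simp: A_def)
  have sub: "B \<subseteq> (\<lambda>n. n + N) ` UNIV"
  proof
    fix n assume "n \<in> B"
    hence n: "n > 0" "n \<noteq> 1" "\<forall>p\<le>N. prime p \<longrightarrow> \<not> p dvd n" by (auto simp: B_def A_def)
    then obtain p where p: "prime p" "p dvd n" using prime_factor_nat by blast
    hence "p \<le> n" "\<not> p \<le> N" using n by (auto intro: dvd_imp_le)
    thus "n \<in> (\<lambda>n. n + N) ` UNIV" by (intro image_eqI[of _ _ "n - N"]) auto
  qed
  have "infsum f (A N) = infsum f ({1} \<union> B)"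
    using one by (simp add: B_def insert_absorb)
  also have "\<dots> = f 1 + infsum f B"
    by (subst infsum_Un_disjoint[OF so so]) (auto simp: B_def)
  finally have "infsum f B = - 1"
    using \<open>infsum f (A N) = 0\<close> by (simp add: f_def add_eq_0_iff)
  hence "1 = norm (infsum f B)" by simp
  also have "\<dots> \<le> infsum (\<lambda>n. norm (f n)) B" by (rule norm_infsum_bound[OF abs])
  also have "\<dots> \<le> infsum (\<lambda>n. norm (f n)) ((\<lambda>n. n + N) ` UNIV)"
    by (intro infsum_mono_neutral abs) (use sub in auto)
  also have "\<dots> = infsum (\<lambda>n. norm (f (n + N))) UNIV"
    by (subst infsum_reindex) (auto simp: o_def inj_on_def)
  also have "\<dots> = (\<Sum>n. norm (f (n + N)))"
    using summable_ignore_initial_segment[OF sm, of N]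
    by (intro infsumI norm_summable_imp_has_sum summable_sums) auto
  finally show False using N by simp
qed

section \<open>The functional equation in a strip\<close>

text \<open>Write 1/(q + p u) as the integral of exp(-(q + p u) v) over v and exchange the
  integrals. The u-integral gives \<open>Gamma z * (v p) powr (- z)\<close>, the v-integral then
  \<open>Gamma (1 - z)\<close>, which is where \<open>0 < Re z < 1\<close> enters.\<close>

lemma has_set_integral_Stieltjes:
  assumes p: "Re p > 0" and q: "Re q > 0" and z: "0 < Re z" "Re z < 1"
  shows "has_set_integral (\<lambda>u. of_real u powr (z - 1) / (q + p * of_real u))
           (Gamma z * Gamma (1 - z) * p powr (- z) * q powr (z - 1)) {0<..}"
proof -
  let ?f = "\<lambda>v u. complex_of_real u powr (z - 1) * exp (- ((q + p * of_real u) * of_real v))"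
  let ?g = "\<lambda>v. Gamma z * p powr (- z) * (complex_of_real v powr (- z) * exp (- (q * of_real v)))"
  let ?h = "\<lambda>v. Gamma (Re z) * Re p powr (- Re z) * (v powr (- Re z) * exp (- (Re q * v)))"
  show ?thesis
  proof (rule has_set_integral_Fubini[where f = ?f and g = ?g and h = ?h])
    show "(\<lambda>(v, u). ?f v u) \<in> borel_measurable borel"
      unfolding borel_prod[symmetric] by measurable
  next
    fix v :: real assume "v \<in> {0<..}"
    hence v: "v > 0" by simp
    have "has_set_integral
        (\<lambda>u. exp (- (q * of_real v)) * (of_real u powr (z - 1) * exp (- (of_real v * p * of_real u))))
        (exp (- (q * of_real v)) * (Gamma z * (of_real v * p) powr (- z))) {0<..}"
      using v p z by (intro has_set_integral_mult_left has_set_integral_Gamma_scaled) auto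
    also have "?this \<longleftrightarrow> has_set_integral (?f v) (?g v) {0<..}"
    proof (rule has_set_integral_cong)
      show "exp (- (q * of_real v)) * (Gamma z * (of_real v * p) powr (- z)) = ?g v"
        using v by (subst powr_times_real_left) (auto simp: mult_ac)
    qed (simp add: exp_add[symmetric] algebra_simps)
    finally show "has_set_integral (?f v) (?g v) {0<..}" .
    have "has_set_integral
        (\<lambda>u. exp (- (Re q * v)) * (u powr (Re z - 1) * exp (- (v * Re p * u))))
        (exp (- (Re q * v)) * (Gamma (Re z) * (v * Re p) powr (- Re z))) {0<..}"
      using v p z by (intro has_set_integral_mult_left has_set_integral_norm_Gamma_scaled) auto
    also have "?this \<longleftrightarrow> has_set_integral (\<lambda>u. norm (?f v u)) (?h v) {0<..}"
    proof (rule has_set_integral_cong)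
      show "exp (- (Re q * v)) * (Gamma (Re z) * (v * Re p) powr (- Re z)) = ?h v"
        using v p by (simp add: powr_mult mult_ac)
    qed (use v in \<open>simp add: norm_mult norm_of_real_powr exp_add[symmetric] algebra_simps\<close>)
    finally show "has_set_integral (\<lambda>u. norm (?f v u)) (?h v) {0<..}" .
  next
    show "set_integrable lborel {0<..} ?h"
      using has_set_integral_mult_left[OF has_set_integral_norm_Gamma_scaled[of "1 - z" "Re q"],
          of "Gamma (Re z) * Re p powr (- Re z)"] z q
      by (simp add: has_set_integral_def)
  next
    fix u :: real assume "u \<in> {0<..}"
    hence u: "u > 0" by simp
    hence w: "Re (q + p * of_real u) > 0" using p q by (simp add: add_pos_pos)
    have "has_set_integral (\<lambda>v. of_real u powr (z - 1) *
        (of_real v powr (1 - 1) * exp (- ((q + p * of_real u) * of_real v))))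
        (of_real u powr (z - 1) * (Gamma 1 * (q + p * of_real u) powr (- 1))) {0<..}"
      using w by (intro has_set_integral_mult_left has_set_integral_Gamma_scaled) auto
    also have "?this \<longleftrightarrow> has_set_integral (\<lambda>v. ?f v u)
        (of_real u powr (z - 1) / (q + p * of_real u)) {0<..}"
    proof (rule has_set_integral_cong)
      have "q + p * of_real u \<noteq> 0" using w by (metis less_irrefl zero_complex.sel(1))
      thus "of_real u powr (z - 1) * (Gamma 1 * (q + p * of_real u) powr (- 1)) =
          of_real u powr (z - 1) / (q + p * of_real u)"
        by (simp add: powr_minus divide_inverse)
    qed auto
    finally show "has_set_integral (\<lambda>v. ?f v u)
        (of_real u powr (z - 1) / (q + p * of_real u)) {0<..}" .
  next
    show "(LINT v:{0<..}|lborel. ?g v) = Gamma z * Gamma (1 - z) * p powr (- z) * q powr (z - 1)"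
      using has_set_integral_mult_left[OF has_set_integral_Gamma_scaled[of "1 - z" q],
          of "Gamma z * p powr (- z)"] z q
      by (simp add: has_set_integral_def mult_ac)
  qed auto
qed

text \<open>Multiplying the denominator by \<open>e\<^sup>-\<^sup>i\<^sup>\<theta>\<close> gives both of its coefficients positive real part, so that
  the poles \<open>t = \<plusminus> i a\<close> are covered.\<close>
lemma has_set_integral_powr_over_rotated:
  assumes s: "-1 < Re s" "Re s < 0" and a: "a > 0" and th: "\<bar>\<theta>\<bar> < pi / 2"
  shows "has_set_integral (\<lambda>t. of_real t powr s / (of_real t + of_real a * exp (2 * \<i> * of_real \<theta>)))
           (Gamma (s + 1) * Gamma (- s) * of_real a powr s * exp (2 * \<i> * of_real \<theta> * s)) {0<..}"
proof -
  define p where "p = exp (- (\<i> * complex_of_real \<theta>))"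
  define q where "q = of_real a * exp (\<i> * complex_of_real \<theta>)"
  have c: "cos \<theta> > 0" using th by (intro cos_gt_zero_pi) auto
  have p: "Re p > 0" and q: "Re q > 0" using c a by (simp_all add: p_def q_def Re_exp)
  have th': "\<bar>\<theta>\<bar> < pi" using th by linarith
  \<comment> \<open>As \<open>\<theta>\<close> lies strictly between -pi and pi, the principal
    logarithm of \<open>p\<close> is exactly \<open>- \<i> * \<theta>\<close>; likewise for
    \<open>q\<close>.\<close>
  have pp: "p powr w = exp (- (\<i> * of_real \<theta> * w))" for w
    using th' by (simp add: p_def powr_def Ln_exp mult_ac)
  have qq: "q powr w = of_real a powr w * exp (\<i> * of_real \<theta> * w)" for w
    using th' a by (simp add: q_def powr_times_real_left) (simp add: powr_def Ln_exp mult_ac)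
  have "has_set_integral (\<lambda>u. p * (of_real u powr (s + 1 - 1) / (q + p * of_real u)))
           (p * (Gamma (s + 1) * Gamma (1 - (s + 1)) * p powr (- (s + 1)) * q powr (s + 1 - 1))) {0<..}"
    by (intro has_set_integral_mult_left has_set_integral_Stieltjes p q) (use s in auto)
  also have "?this \<longleftrightarrow> ?thesis"
  proof (rule has_set_integral_cong)
    fix t :: real
    have e: "q + p * of_real t = p * (of_real t + of_real a * exp (2 * \<i> * of_real \<theta>))"
      by (simp add: p_def q_def algebra_simps flip: exp_add)
    have "p \<noteq> 0" by (simp add: p_def)
    thus "p * (of_real t powr (s + 1 - 1) / (q + p * of_real t)) =
      of_real t powr s / (of_real t + of_real a * exp (2 * \<i> * of_real \<theta>))"
      unfolding e by simp
  next
    have "p * (p powr (- (s + 1)) * q powr s) = of_real a powr s * exp (2 * \<i> * of_real \<theta> * s)"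
      unfolding pp qq unfolding p_def by (simp add: mult_ac flip: exp_add) (simp add: algebra_simps)
    thus "p * (Gamma (s + 1) * Gamma (1 - (s + 1)) * p powr (- (s + 1)) * q powr (s + 1 - 1)) =
      Gamma (s + 1) * Gamma (- s) * of_real a powr s * exp (2 * \<i> * of_real \<theta> * s)"
      by (simp add: mult_ac)
  qed
  finally show ?thesis .
qed

text \<open>Partial fractions over the poles at i a and -i a. The angles pi/4 and -pi/4 turn
  \<open>exp (2 * \<i> * \<theta>)\<close> into i and -i, and the difference of the two phases is
  the sine.\<close>

lemma has_set_integral_powr_over_square_plus_square:
  assumes s: "-1 < Re s" "Re s < 0" and a: "a > 0"
  shows "has_set_integral (\<lambda>t. of_real t powr s * of_real (2 / (t\<^sup>2 + a\<^sup>2)))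
           (- 2 * sin (of_real pi * s / 2) * Gamma (s + 1) * Gamma (- s) * of_real a powr (s - 1)) {0<..}"
proof -
  let ?G = "Gamma (s + 1) * Gamma (- s) * of_real a powr s"
  let ?F = "\<lambda>\<theta> t. of_real t powr s / (of_real t + of_real a * exp (2 * \<i> * of_real \<theta>))"
  have e1: "exp (2 * \<i> * complex_of_real (pi / 4)) = \<i>"
    using cis_pi_half by (simp add: cis_conv_exp)
  have e2: "exp (2 * \<i> * complex_of_real (- pi / 4)) = - \<i>"
    using e1 by (simp add: exp_minus)
  have "has_set_integral (\<lambda>t. 1 / (\<i> * of_real a) * ?F (- pi / 4) t + - 1 / (\<i> * of_real a) * ?F (pi / 4) t)
     (1 / (\<i> * of_real a) * (?G * exp (2 * \<i> * of_real (- pi / 4) * s)) +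
      - 1 / (\<i> * of_real a) * (?G * exp (2 * \<i> * of_real (pi / 4) * s))) {0<..}"
    using s a by (intro has_set_integral_add has_set_integral_mult_left has_set_integral_powr_over_rotated)
      auto
  also have "?this \<longleftrightarrow> ?thesis"
  proof (rule has_set_integral_cong)
    fix t :: real assume "t \<in> {0<..}"
    hence t: "t > 0" by simp
    have n1: "complex_of_real t - of_real a * \<i> \<noteq> 0" and n2: "complex_of_real t + of_real a * \<i> \<noteq> 0"
      using t by (auto simp: complex_eq_iff)
    have "(complex_of_real t)\<^sup>2 + (of_real a)\<^sup>2 =
        (complex_of_real t - of_real a * \<i>) * (of_real t + of_real a * \<i>)"
      by (simp add: power2_eq_square algebra_simps)
    hence eq: "of_real (2 / (t\<^sup>2 + a\<^sup>2)) = 1 / (\<i> * of_real a) * (1 / (complex_of_real t - of_real a * \<i>))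
        - 1 / (\<i> * of_real a) * (1 / (complex_of_real t + of_real a * \<i>))"
      using n1 n2 a by (simp add: divide_simps)
    show "1 / (\<i> * of_real a) * ?F (- pi / 4) t + - 1 / (\<i> * of_real a) * ?F (pi / 4) t =
        of_real t powr s * of_real (2 / (t\<^sup>2 + a\<^sup>2))"
      unfolding e1 e2 eq by (simp add: right_diff_distrib)
  next
    have sn: "sin (of_real pi * s / 2) =
        (exp (2 * \<i> * of_real (pi / 4) * s) - exp (2 * \<i> * of_real (- pi / 4) * s)) / (2 * \<i>)"
      by (simp add: sin_exp_eq mult_ac)
    have pa: "of_real a powr (s - 1) = of_real a powr s / complex_of_real a"
      using a by (simp add: powr_diff)
    show "1 / (\<i> * of_real a) * (?G * exp (2 * \<i> * of_real (- pi / 4) * s)) +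
      - 1 / (\<i> * of_real a) * (?G * exp (2 * \<i> * of_real (pi / 4) * s)) =
      - 2 * sin (of_real pi * s / 2) * Gamma (s + 1) * Gamma (- s) * of_real a powr (s - 1)"
      unfolding sn pa using a by (simp add: field_simps)
  qed
  finally show ?thesis .
qed

section \<open>Partial fractions of the cotangent from the logarithmic derivative of Euler's
  reflection formula\<close>

lemma Digamma_reflection_complex:
  assumes "sin (of_real pi * z) \<noteq> (0 :: complex)"
  shows "Digamma (1 - z) - Digamma z = of_real pi * cos (of_real pi * z) / sin (of_real pi * z)"
proof -
  have z: "z \<notin> \<int>"
  proof
    assume "z \<in> \<int>"
    then obtain n where "z = of_int n" by (elim Ints_cases)
    thus False using assms sin_eq_0[of "of_real pi * z"] by auto
  qed
  hence n1: "z \<notin> \<int>\<^sub>\<le>\<^sub>0" using nonpos_Ints_Int by blast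
  have n2: "1 - z \<notin> \<int>\<^sub>\<le>\<^sub>0"
    using z nonpos_Ints_Int[of "1 - z"] by (auto simp: algebra_simps dest: Ints_diff[of 1 "1 - z"])
  let ?F = "Gamma z * Gamma (1 - z)"
  have "((\<lambda>w. Gamma w * Gamma (1 - w)) has_field_derivative ?F * (Digamma z - Digamma (1 - z))) (at z)"
    using n1 n2 by (auto intro!: derivative_eq_intros simp: algebra_simps)
  moreover have "((\<lambda>w. of_real pi / sin (of_real pi * w)) has_field_derivative
      - (?F * (of_real pi * cos (of_real pi * z) / sin (of_real pi * z)))) (at z)"
    unfolding Gamma_reflection_complex
    using assms by (auto intro!: derivative_eq_intros simp: field_simps)
  moreover have "(\<lambda>w. Gamma w * Gamma (1 - w)) = (\<lambda>w. complex_of_real pi / sin (of_real pi * w))"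
    by (intro ext Gamma_reflection_complex)
  ultimately have "?F * (Digamma z - Digamma (1 - z)) =
      - (?F * (of_real pi * cos (of_real pi * z) / sin (of_real pi * z)))"
    using DERIV_unique by metis
  moreover have "?F \<noteq> 0" using n1 n2 by (simp add: Gamma_eq_zero_iff)
  ultimately have "Digamma z - Digamma (1 - z) = - (of_real pi * cos (of_real pi * z) / sin (of_real pi * z))"
    by (metis mult_cancel_left mult_minus_right)
  thus ?thesis by (simp add: algebra_simps)
qed

text \<open>The right-hand side is coth(t/2)/2 - 1/t, that is 1/(exp t - 1) - 1/t + 1/2. Subtracting
  the digamma series at \<open>1 + z\<close> from that at \<open>1 - z\<close> pairs opposite poles;
  shifting \<open>1 + z\<close> to \<open>z\<close> by the recurrence accounts for the term
  -1/t.\<close>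

lemma coth_partial_fractions:
  assumes t: "t > (0 :: real)"
  shows "(\<lambda>k. 2 * t / (t\<^sup>2 + (2 * pi * real (Suc k))\<^sup>2)) sums
    ((1 + exp (- t)) / (2 * (1 - exp (- t))) - 1 / t)"
proof -
  \<comment> \<open>Chosen so that \<open>pi * z\<close> is i t/2, which turns the cotangent into a
    hyperbolic one.\<close>
  define z where "z = \<i> * complex_of_real (t / (2 * pi))"
  have pz: "of_real pi * z = \<i> * complex_of_real (t / 2)" by (simp add: z_def)
  have et: "exp (- t) < 1" using t by simp
  define E where "E = exp (complex_of_real (t / 2))"
  have E2: "E * E = of_real (exp t)"
    by (simp add: E_def exp_of_real flip: exp_add)
  have E0: "E \<noteq> 0" by (simp add: E_def)
  have E1: "E * E \<noteq> 1" unfolding E2 using t by (metis exp_eq_one_iff of_real_eq_1_iff less_irrefl)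
  have sn: "sin (of_real pi * z) = \<i> * ((E - inverse E) / 2)"
    unfolding pz sin_i_times E_def by simp
  have cn: "cos (of_real pi * z) = (E + inverse E) / 2"
    unfolding pz cos_i_times E_def by simp
  have "sin (of_real pi * z) \<noteq> 0"
    unfolding sn using E0 E1 by (simp add: field_simps)
  hence refl: "Digamma (1 - z) - Digamma z = of_real pi * ((E + inverse E) / 2) / (\<i> * ((E - inverse E) / 2))"
    using Digamma_reflection_complex[of z] unfolding sn cn by simp
  have z0: "z \<noteq> 0" using t by (simp add: z_def)
  have zi: "1 - z \<noteq> 0" "1 + z \<noteq> 0" by (auto simp: z_def complex_eq_iff)
  have D: "(\<lambda>k. inverse (of_nat (Suc k)) - inverse (w + of_nat k)) sums (Digamma w + euler_mascheroni)"
    if "w \<noteq> 0" for w :: complex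
    using summable_Digamma[OF that] by (simp add: Digamma_def sums_iff)
  have "(\<lambda>k. (inverse (of_nat (Suc k)) - inverse (1 - z + of_nat k)) -
      (inverse (of_nat (Suc k)) - inverse (1 + z + of_nat k))) sums
      ((Digamma (1 - z) + euler_mascheroni) - (Digamma (1 + z) + euler_mascheroni))"
    by (intro sums_diff D zi)
  also have "(\<lambda>k. (inverse (of_nat (Suc k)) - inverse (1 - z + of_nat k)) -
      (inverse (of_nat (Suc k)) - inverse (1 + z + of_nat k))) =
      (\<lambda>k. - (2 * of_real pi * \<i>) * of_real (2 * t / (t\<^sup>2 + (2 * pi * real (Suc k))\<^sup>2)))"
  proof
    fix k
    have n1: "1 - z + of_nat k \<noteq> 0" and n2: "1 + z + of_nat k \<noteq> 0"
      by (auto simp: z_def complex_eq_iff)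
    have "(1 - z + of_nat k) * (1 + z + of_nat k) =
        of_real ((t\<^sup>2 + (2 * pi * real (Suc k))\<^sup>2) / (2 * pi)\<^sup>2)"
      by (simp add: z_def power2_eq_square field_simps)
    hence n3: "inverse (1 - z + of_nat k) * inverse (1 + z + of_nat k) =
        of_real ((2 * pi)\<^sup>2 / (t\<^sup>2 + (2 * pi * real (Suc k))\<^sup>2))"
      unfolding inverse_mult_distrib[symmetric] by simp
    have "(inverse (of_nat (Suc k)) - inverse (1 - z + of_nat k)) -
      (inverse (of_nat (Suc k)) - inverse (1 + z + of_nat k)) =
      - (2 * z) * (inverse (1 - z + of_nat k) * inverse (1 + z + of_nat k))"
      using n1 n2 by (simp add: field_simps)
    also have "\<dots> = - (2 * of_real pi * \<i>) * of_real (2 * t / (t\<^sup>2 + (2 * pi * real (Suc k))\<^sup>2))"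
      unfolding n3 by (simp add: z_def power2_eq_square field_simps)
    finally show "(inverse (of_nat (Suc k)) - inverse (1 - z + of_nat k)) -
      (inverse (of_nat (Suc k)) - inverse (1 + z + of_nat k)) =
      - (2 * of_real pi * \<i>) * of_real (2 * t / (t\<^sup>2 + (2 * pi * real (Suc k))\<^sup>2))" .
  qed
  also have "(Digamma (1 - z) + euler_mascheroni) - (Digamma (1 + z) + euler_mascheroni) =
      (Digamma (1 - z) - Digamma z) - 1 / z"
    using Digamma_plus1[OF z0] by (simp add: add.commute)
  also have "\<dots> = - (2 * of_real pi * \<i>) * of_real ((1 + exp (- t)) / (2 * (1 - exp (- t))) - 1 / t)"
  proof -
    have x: "complex_of_real (exp (- t)) = inverse (E * E)"
      unfolding E2 by (simp add: exp_minus)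
    have "(E + inverse E) / (E - inverse E) = (1 + inverse (E * E)) / (1 - inverse (E * E))"
      using E0 E1 by (simp add: field_simps)
    moreover have "of_real pi * (A / 2) / (\<i> * (B / 2)) = - \<i> * of_real pi * (A / B)" for A B :: complex
      by (cases "B = 0") (auto simp: field_simps)
    ultimately have 1: "of_real pi * ((E + inverse E) / 2) / (\<i> * ((E - inverse E) / 2)) =
        - \<i> * of_real pi * ((1 + inverse (E * E)) / (1 - inverse (E * E)))"
      by metis
    have 2: "1 / z = - \<i> * of_real (2 * pi / t)"
      using t by (simp add: z_def field_simps)
    have 3: "complex_of_real ((1 + exp (- t)) / (2 * (1 - exp (- t))) - 1 / t) =
        (1 + inverse (E * E)) / (1 - inverse (E * E)) / 2 - 1 / of_real t"
      by (simp add: x)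
    have "- \<i> * of_real pi * C - (- \<i> * of_real (2 * pi / t)) =
        - (2 * of_real pi * \<i>) * (C / 2 - 1 / of_real t)" for C :: complex
      by (simp add: field_simps)
    thus ?thesis unfolding refl 1 2 3 .
  qed
  finally have "(\<lambda>k. - (2 * of_real pi * \<i>) * complex_of_real (2 * t / (t\<^sup>2 + (2 * pi * real (Suc k))\<^sup>2))) sums
      (- (2 * of_real pi * \<i>) * of_real ((1 + exp (- t)) / (2 * (1 - exp (- t))) - 1 / t))" .
  hence "(\<lambda>k. complex_of_real (2 * t / (t\<^sup>2 + (2 * pi * real (Suc k))\<^sup>2))) sums
      of_real ((1 + exp (- t)) / (2 * (1 - exp (- t))) - 1 / t)"
    by (subst (asm) sums_mult_iff) auto
  thus ?thesis by (simp only: sums_of_real_iff)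
qed

section \<open>Mellin transform of the trapezoidal kernel, one unit interval at a time\<close>

text \<open>The point \<open>0\<close> is removed because the kernel \<open>x\<^sup>-\<^sup>s\<^sup>-\<^sup>2\<close> is singular there.\<close>
definition unit_piece :: "nat \<Rightarrow> real set" where
  "unit_piece n = {real n..real n + 1} \<inter> {0<..}"

text \<open>For \<open>n = 0\<close> this is the trapezoidal error on [0, 1] with 0^(-s) = 0^(1-s) =
  0, as is right for Re s < 0. The leading term of \<open>zeta_numerator\<close> thus becomes one
  more piece of the same integral.\<close>

definition zeta_piece :: "nat \<Rightarrow> complex \<Rightarrow> complex" where
  "zeta_piece n s = (if n = 0 then (s + 1) / 2 else trapezoid_term n s)"

text \<open>Closed form of the Laplace transform of the trapezoidal kernel on
  \<open>unit_piece n\<close>. It depends on \<open>n\<close> only through exp(-n t), so summing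
  over \<open>n\<close> is a geometric series.\<close>

definition piece_Laplace :: "nat \<Rightarrow> real \<Rightarrow> real" where
  "piece_Laplace n t = exp (- (real n * t)) * ((1 + exp (- t)) / 2 - (1 - exp (- t)) / t) / t\<^sup>2"

lemma unit_piece_measurable [measurable]: "unit_piece n \<in> sets borel"
  by (simp add: unit_piece_def)

lemma has_set_integral_Icc:
  fixes f :: "real \<Rightarrow> complex"
  assumes "continuous_on {a..b} f" "(f has_integral v) {a..b}"
  shows "has_set_integral f v {a..b}"
proof -
  have i: "set_integrable lborel {a..b} f"
    using borel_integrable_atLeastAtMost'[OF assms(1)] .
  show ?thesis
    using i set_borel_integral_eq_integral(2)[OF i] integral_unique[OF assms(2)]
    by (simp add: has_set_integral_def)
qed

text \<open>The integrand may be unbounded at 0, so absolute integrability is obtained separately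
  from the real power, and the value from the fundamental theorem on the interior.\<close>

lemma has_set_integral_powr_unit:
  assumes "Re c > -1"
  shows "has_set_integral (\<lambda>x. of_real x powr c) (1 / (c + 1)) {0<..1}"
proof -
  have [measurable]: "(\<lambda>x. indicat_real {0<..1} x *\<^sub>R complex_of_real x powr c) \<in> borel_measurable lborel"
    "(\<lambda>x. indicat_real {0<..1} x *\<^sub>R (x powr Re c)) \<in> borel_measurable lborel"
    by measurable
  have "(\<lambda>x. x powr Re c) absolutely_integrable_on {0<..1}"
    using assms by (intro nonnegative_absolutely_integrable_1 integrable_on_powr_from_0') auto
  hence "integrable lborel (\<lambda>x. indicat_real {0<..1} x *\<^sub>R (x powr Re c))"
    unfolding set_integrable_def by (subst (asm) integrable_completion) auto
  hence "integrable lborel (\<lambda>x. indicat_real {0<..1} x *\<^sub>R complex_of_real x powr c)"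
    by (rule Bochner_Integration.integrable_bound)
       (auto simp: indicator_def norm_of_real_powr)
  hence i: "set_integrable lborel {0<..1} (\<lambda>x. complex_of_real x powr c)"
    by (simp add: set_integrable_def)
  have c1: "c + 1 \<noteq> 0" using assms by (auto simp: complex_eq_iff)
  have "((\<lambda>t. complex_of_real t powr c) has_integral
          (of_real 1 powr (c + 1) / (c + 1) - of_real 0 powr (c + 1) / (c + 1))) {0..1}"
    using assms c1 by (intro fundamental_theorem_of_calculus_interior)
      (auto intro!: continuous_intros derivative_eq_intros has_vector_derivative_real_field)
  hence "((\<lambda>t. complex_of_real t powr c) has_integral 1 / (c + 1)) {0..1}" by simp
  also have "?this \<longleftrightarrow> ((\<lambda>t. complex_of_real t powr c) has_integral 1 / (c + 1)) {0<..1}"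
    by (rule has_integral_spike_set_eq) (auto intro: negligible_subset[of "{0}"])
  finally show ?thesis
    using i set_borel_integral_eq_integral(2)[OF i] by (simp add: has_set_integral_def integral_unique)
qed

lemma has_set_integral_unit_piece:
  assumes "has_set_integral f v {real n..real n + 1}"
  shows "has_set_integral f v (unit_piece n)"
proof -
  have "has_bochner_integral lborel (\<lambda>x. indicat_real {real n..real n + 1} x *\<^sub>R f x) v"
    using assms by (simp add: has_set_integral_iff_has_bochner_integral)
  moreover have "AE x in lborel. indicat_real {real n..real n + 1} x *\<^sub>R f x =
      indicat_real (unit_piece n) x *\<^sub>R f x"
    using AE_lborel_singleton[of 0] by eventually_elim (auto simp: unit_piece_def indicator_def)
  moreover have "(\<lambda>x. indicat_real (unit_piece n) x *\<^sub>R f x) \<in> borel_measurable lborel"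
  proof -
    have "(\<lambda>x. indicat_real {real n..real n + 1} x *\<^sub>R f x) \<in> borel_measurable lborel"
      using assms by (auto simp: has_set_integral_def set_integrable_def)
    hence "(\<lambda>x. indicat_real {0<..} x *\<^sub>R (indicat_real {real n..real n + 1} x *\<^sub>R f x))
        \<in> borel_measurable lborel"
      by measurable
    also have "(\<lambda>x. indicat_real {0<..} x *\<^sub>R (indicat_real {real n..real n + 1} x *\<^sub>R f x)) =
        (\<lambda>x. indicat_real (unit_piece n) x *\<^sub>R f x)"
      by (auto simp: unit_piece_def indicator_def)
    finally show ?thesis .
  qed
  ultimately show ?thesis
    unfolding has_set_integral_iff_has_bochner_integral
    using has_bochner_integral_cong_AE[THEN iffD1, OF borel_measurable_has_bochner_integral] by blast
qed

text \<open>For \<open>n > 0\<close> this is the trapezoidal identity divided by its constant. For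
  \<open>n = 0\<close> the integrand is \<open>(x powr (- s - 1) - x powr (- s)) / 2\<close>,
  integrable at 0 because \<open>Re s < 0\<close>.\<close>

lemma has_set_integral_zeta_piece:
  assumes s: "-1 < Re s" "Re s < 0"
  shows "has_set_integral
    (\<lambda>x. of_real ((x - real n) * (real n + 1 - x) / 2) * of_real x powr (- s - 2))
    (zeta_piece n s / ((s - 1) * s * (s + 1))) (unit_piece n)"
proof -
  have nz: "s - 1 \<noteq> 0" "s \<noteq> 0" "s + 1 \<noteq> 0" using s by (auto simp: complex_eq_iff)
  show ?thesis
  proof (cases "n = 0")
    case True
    have "has_set_integral (\<lambda>x. 1 / 2 * of_real x powr (- s - 1) + (- 1 / 2) * of_real x powr (- s))
        (1 / 2 * (1 / (- s - 1 + 1)) + (- 1 / 2) * (1 / (- s + 1))) {0<..1}"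
      using s by (intro has_set_integral_add has_set_integral_mult_left has_set_integral_powr_unit) auto
    also have "{0<..1} = unit_piece n"
      using True by (auto simp: unit_piece_def)
    also have "has_set_integral (\<lambda>x. 1 / 2 * of_real x powr (- s - 1) + (- 1 / 2) * of_real x powr (- s))
        (1 / 2 * (1 / (- s - 1 + 1)) + (- 1 / 2) * (1 / (- s + 1))) (unit_piece n) \<longleftrightarrow> ?thesis"
    proof (rule has_set_integral_cong)
      fix x assume "x \<in> unit_piece n"
      hence x: "x > 0" by (simp add: unit_piece_def)
      have p1: "complex_of_real x powr (c + 1) = of_real x * of_real x powr c" for c
        using x by (simp add: powr_add)
      have 1: "complex_of_real x powr (- s - 1) = of_real x * of_real x powr (- s - 2)"
      proof -
        have "- s - 2 + 1 = - s - 1" by simp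
        thus ?thesis using p1[of "- s - 2"] by (simp only:)
      qed
      have 2: "complex_of_real x powr (- s) = (of_real x)\<^sup>2 * of_real x powr (- s - 2)"
        using p1[of "- s - 1"] unfolding 1 by (simp add: power2_eq_square)
      show "1 / 2 * complex_of_real x powr (- s - 1) + (- 1 / 2) * of_real x powr (- s) =
          of_real ((x - real n) * (real n + 1 - x) / 2) * of_real x powr (- s - 2)"
        unfolding 1 2 using True by (simp add: power2_eq_square field_simps)
    next
      have e: "- s - 1 + 1 = - s" "- s + 1 = - (s - 1)" by auto
      have "zeta_piece n s / ((s - 1) * s * (s + 1)) = 1 / (2 * ((s - 1) * s))"
        using True nz by (simp add: zeta_piece_def)
      also have "\<dots> = 1 / 2 * (1 / (s - 1) - 1 / s)"
        using nz(1,2) by (simp add: diff_frac_eq)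
      finally have z: "zeta_piece n s / ((s - 1) * s * (s + 1)) = 1 / 2 * (1 / (s - 1) - 1 / s)" .
      have "1 / 2 * - a + (- 1 / 2) * - b = 1 / 2 * (b - a)" for a b :: complex
        by (simp add: field_simps)
      thus "1 / 2 * (1 / (- s - 1 + 1)) + (- 1 / 2) * (1 / (- s + 1)) =
          zeta_piece n s / ((s - 1) * s * (s + 1))"
        unfolding e z divide_minus_right .
    qed
    finally show ?thesis .
  next
    case False
    let ?C = "(s - 1) * s * (s + 1)"
    have cc: "1 / ?C * (?C * y) = y" for y using nz by simp
    have v: "1 / ?C * trapezoid_term n s = zeta_piece n s / ?C"
      using False by (simp add: zeta_piece_def)
    have "((\<lambda>x. 1 / ?C * (?C * (of_real ((x - real n) * (real n + 1 - x) / 2) *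
        of_real x powr (- s - 2)))) has_integral 1 / ?C * trapezoid_term n s) {real n..real n + 1}"
      using False by (intro has_integral_mult_right has_integral_trapezoid_kernel) auto
    hence "((\<lambda>x. of_real ((x - real n) * (real n + 1 - x) / 2) * of_real x powr (- s - 2))
        has_integral zeta_piece n s / ?C) {real n..real n + 1}"
      unfolding cc v .
    thus ?thesis using False
      by (intro has_set_integral_unit_piece has_set_integral_Icc)
         (auto intro!: continuous_intros simp: complex_nonpos_Reals_iff)
  qed
qed

lemma has_set_integral_piece_Laplace:
  assumes t: "t > 0"
  shows "has_set_integral
    (\<lambda>x. of_real ((x - real n) * (real n + 1 - x) / 2) * exp (- (of_real x * of_real t)))
    (complex_of_real (piece_Laplace n t)) (unit_piece n)"
proof (intro has_set_integral_unit_piece has_set_integral_Icc)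
  \<comment> \<open>Repeated integration by parts gives -exp(-x t) (q/t + q'/t^2 + q''/t^3), where
    q'' = -1.\<close>
  let ?F = "\<lambda>x. - exp (- (x * t)) * ((x - real n) * (real n + 1 - x) / 2 / t +
      (real n + 1 / 2 - x) / t\<^sup>2 - 1 / t ^ 3)"
  have "((\<lambda>x. (x - real n) * (real n + 1 - x) / 2 * exp (- (x * t))) has_integral
      ?F (real n + 1) - ?F (real n)) {real n..real n + 1}"
  proof (rule fundamental_theorem_of_calculus)
    fix x assume "x \<in> {real n..real n + 1}"
    have "(?F has_real_derivative (x - real n) * (real n + 1 - x) / 2 * exp (- (x * t))) (at x)"
      using t by (auto intro!: derivative_eq_intros)
        (simp add: field_simps eval_nat_numeral)
    thus "(?F has_vector_derivative (x - real n) * (real n + 1 - x) / 2 * exp (- (x * t)))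
        (at x within {real n..real n + 1})"
      using has_real_derivative_iff_has_vector_derivative has_vector_derivative_at_within by blast
  qed auto
  also have "?F (real n + 1) - ?F (real n) = piece_Laplace n t"
    using t by (simp add: piece_Laplace_def distrib_right exp_add exp_diff exp_minus field_simps
        power2_eq_square power3_eq_cube)
  finally have "((\<lambda>x. complex_of_real ((x - real n) * (real n + 1 - x) / 2 * exp (- (x * t))))
      has_integral of_real (piece_Laplace n t)) {real n..real n + 1}"
    by (rule has_integral_of_real)
  thus "((\<lambda>x. of_real ((x - real n) * (real n + 1 - x) / 2) * exp (- (of_real x * of_real t)))
      has_integral complex_of_real (piece_Laplace n t)) {real n..real n + 1}"
    by (simp add: exp_of_real[symmetric])
qed (auto intro!: continuous_intros)

text \<open>Replace \<open>Gamma (s + 2) * x powr (- s - 2)\<close> in the kernel integral by its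
  Gamma integral over t and exchange the integrals; the inner x-integral is then the Laplace
  transform.\<close>

lemma has_set_integral_Mellin_piece_Laplace:
  assumes s: "-1 < Re s" "Re s < 0"
  shows "has_set_integral (\<lambda>t. of_real t powr (s + 1) * of_real (piece_Laplace n t))
    (Gamma (s + 2) * (zeta_piece n s / ((s - 1) * s * (s + 1)))) {0<..}"
proof -
  let ?q = "\<lambda>x. (x - real n) * (real n + 1 - x) / 2"
  let ?f = "\<lambda>x t. complex_of_real (?q x) * (of_real t powr (s + 1) * exp (- (of_real x * of_real t)))"
  let ?g = "\<lambda>x. complex_of_real (?q x) * (Gamma (s + 2) * of_real x powr (- s - 2))"
  let ?h = "\<lambda>x. ?q x * (Gamma (Re s + 2) * x powr (- Re s - 2))"
  have q0: "?q x \<ge> 0" if "x \<in> unit_piece n" for x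
    using that trapezoid_kernel_bounds(1)[of x "real n"] by (auto simp: unit_piece_def)
  show ?thesis
  proof (rule has_set_integral_Fubini[where f = ?f and g = ?g and h = ?h and A = "unit_piece n"])
    show "(\<lambda>(x, t). ?f x t) \<in> borel_measurable borel"
      unfolding borel_prod[symmetric] by measurable
  next
    fix x assume xn: "x \<in> unit_piece n"
    hence x: "x > 0" by (simp add: unit_piece_def)
    have "has_set_integral (?f x) (complex_of_real (?q x) * (Gamma (s + 2) * of_real x powr (- (s + 2)))) {0<..}"
      using has_set_integral_Gamma_scaled[of "s + 2" "of_real x"] s x
      by (intro has_set_integral_mult_left) (simp add: add_diff_eq[symmetric])
    thus "has_set_integral (?f x) (?g x) {0<..}" by simp
    have "has_set_integral (\<lambda>t. ?q x * (t powr (Re (s + 2) - 1) * exp (- (x * t))))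
        (?q x * (Gamma (Re (s + 2)) * x powr (- Re (s + 2)))) {0<..}"
      using s x by (intro has_set_integral_mult_left has_set_integral_norm_Gamma_scaled) auto
    also have "?this \<longleftrightarrow> has_set_integral (\<lambda>t. norm (?f x t)) (?h x) {0<..}"
      using q0[OF xn]
      by (intro has_set_integral_cong)
         (auto simp: norm_mult norm_of_real_powr add.commute simp del: of_real_mult of_real_divide of_real_diff of_real_add)
    finally show "has_set_integral (\<lambda>t. norm (?f x t)) (?h x) {0<..}" .
  next
    have "has_set_integral (\<lambda>x. Gamma (Re s + 2) *
        Re (complex_of_real (?q x) * of_real x powr (- of_real (Re s) - 2)))
       (Gamma (Re s + 2) * Re (zeta_piece n (of_real (Re s)) /
          ((of_real (Re s) - 1) * of_real (Re s) * (of_real (Re s) + 1)))) (unit_piece n)"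
      using s by (intro has_set_integral_mult_left has_set_integral_Re has_set_integral_zeta_piece) auto
    also have "?this \<longleftrightarrow> has_set_integral ?h (Gamma (Re s + 2) * Re (zeta_piece n (of_real (Re s)) /
          ((of_real (Re s) - 1) * of_real (Re s) * (of_real (Re s) + 1)))) (unit_piece n)"
    proof (intro has_set_integral_cong refl)
      fix x assume "x \<in> unit_piece n"
      hence "complex_of_real x powr (- of_real (Re s) - 2) = of_real (x powr (- Re s - 2))"
        by (simp add: powr_of_real[symmetric] unit_piece_def)
      thus "Gamma (Re s + 2) * Re (complex_of_real (?q x) * of_real x powr (- of_real (Re s) - 2)) = ?h x"
        by simp
    qed
    finally show "set_integrable lborel (unit_piece n) ?h" by (simp add: has_set_integral_def)
  next
    fix t :: real assume "t \<in> {0<..}"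
    hence "has_set_integral (\<lambda>x. of_real t powr (s + 1) * (of_real (?q x) * exp (- (of_real x * of_real t))))
        (of_real t powr (s + 1) * complex_of_real (piece_Laplace n t)) (unit_piece n)"
      by (intro has_set_integral_mult_left has_set_integral_piece_Laplace) auto
    thus "has_set_integral (\<lambda>x. ?f x t) (of_real t powr (s + 1) * complex_of_real (piece_Laplace n t)) (unit_piece n)"
      by (simp only: mult.left_commute[of "of_real t powr (s + 1)"])
  next
    show "(LINT x:unit_piece n|lborel. ?g x) = Gamma (s + 2) * (zeta_piece n s / ((s - 1) * s * (s + 1)))"
      using has_set_integral_mult_left[OF has_set_integral_zeta_piece[OF s, of n], of "Gamma (s + 2)"]
      by (simp only: mult.left_commute[of "Gamma (s + 2)"] has_set_integral_def)
  qed auto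
qed

text \<open>The sign is hidden in the closed form but evident from the Laplace integral. It makes
  the norm of each Mellin integrand equal to the integrand at \<open>Re s\<close>.\<close>

lemma piece_Laplace_nonneg: "t > 0 \<Longrightarrow> piece_Laplace n t \<ge> 0"
proof -
  assume t: "t > 0"
  have "has_set_integral (\<lambda>x. Re (of_real ((x - real n) * (real n + 1 - x) / 2) *
      exp (- (of_real x * of_real t)))) (Re (complex_of_real (piece_Laplace n t))) (unit_piece n)"
    by (intro has_set_integral_Re has_set_integral_piece_Laplace t)
  hence "piece_Laplace n t = (LINT x:unit_piece n|lborel. Re (of_real ((x - real n) * (real n + 1 - x) / 2) *
      exp (- (complex_of_real x * of_real t))))"
    by (simp add: has_set_integral_def)
  also have "\<dots> \<ge> 0"
    unfolding set_lebesgue_integral_def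
  proof (intro integral_nonneg_AE AE_I2)
    fix x
    show "indicat_real (unit_piece n) x *\<^sub>R Re (of_real ((x - real n) * (real n + 1 - x) / 2) *
      exp (- (complex_of_real x * of_real t))) \<ge> 0"
      using trapezoid_kernel_bounds(1)[of x "real n"]
      by (auto simp: indicator_def unit_piece_def Re_exp)
  qed
  finally show ?thesis .
qed

lemma sums_piece_Laplace:
  assumes t: "t > 0"
  shows "(\<lambda>n. piece_Laplace n t) sums (((1 + exp (- t)) / (2 * (1 - exp (- t))) - 1 / t) / t\<^sup>2)"
proof -
  have "norm (exp (- t)) < 1" using t by simp
  hence "(\<lambda>n. exp (- t) ^ n * (((1 + exp (- t)) / 2 - (1 - exp (- t)) / t) / t\<^sup>2)) sums
      (1 / (1 - exp (- t)) * (((1 + exp (- t)) / 2 - (1 - exp (- t)) / t) / t\<^sup>2))"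
    by (intro sums_mult2 geometric_sums)
  also have "(\<lambda>n. exp (- t) ^ n * (((1 + exp (- t)) / 2 - (1 - exp (- t)) / t) / t\<^sup>2)) =
      (\<lambda>n. piece_Laplace n t)"
    by (auto simp: piece_Laplace_def exp_of_nat_mult[symmetric])
  also have "1 / (1 - exp (- t)) * (((1 + exp (- t)) / 2 - (1 - exp (- t)) / t) / t\<^sup>2) =
      ((1 + exp (- t)) / (2 * (1 - exp (- t))) - 1 / t) / t\<^sup>2"
  proof -
    have "1 - exp (- t) \<noteq> 0" using t by simp
    moreover have "1 / X * ((Y / 2 - X / t) / t\<^sup>2) = (Y / (2 * X) - 1 / t) / t\<^sup>2" if "X \<noteq> 0" for X Y :: real
      using t that by (simp add: field_simps)
    ultimately show ?thesis by blast
  qed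
  finally show ?thesis .
qed

lemma sums_zeta_piece:
  assumes "-1 < Re s"
  shows "(\<lambda>n. zeta_piece n s) sums zeta_numerator s"
proof -
  have "(\<lambda>n. zeta_piece (Suc n) s) sums (\<Sum>n. trapezoid_term (Suc n) s)"
    using norm_zeta_numerator_diff_le(1)[OF order_refl assms] by (simp add: zeta_piece_def sums_iff)
  hence "(\<lambda>n. zeta_piece n s) sums ((\<Sum>n. trapezoid_term (Suc n) s) + zeta_piece 0 s)"
    by (rule sums_Suc)
  thus ?thesis by (simp add: zeta_piece_def zeta_numerator_def add.commute)
qed

section \<open>Comparison of the two evaluations\<close>

theorem zeta_functional_equation_strip:
  assumes s: "-1 < Re s" "Re s < 0"
  shows "zeta_numerator s = (s - 1) * (2 * of_real (2 * pi) powr (s - 1) * sin (of_real pi * s / 2) *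
    Gamma (1 - s) * dirichlet_zeta (1 - s))"
proof -
  \<comment> \<open>All norms of integrands at \<open>s\<close> are integrands at this real point,
    so the dominating series are the evaluated series themselves, taken at
    \<open>\<sigma>\<close>.\<close>
  define \<sigma> where "\<sigma> = complex_of_real (Re s)"
  have \<sigma>: "-1 < Re \<sigma>" "Re \<sigma> < 0" using s by (simp_all add: \<sigma>_def)
  define C where "C = (\<lambda>z::complex. (z - 1) * z * (z + 1))"
  define a where "a = (\<lambda>k. 2 * pi * real (Suc k))"
  have a: "a k > 0" for k by (simp add: a_def)
  define B where "B = (\<lambda>z::complex. - 2 * sin (of_real pi * z / 2) * Gamma (z + 1) * Gamma (- z))"
  define \<Phi> where "\<Phi> = (\<lambda>t. complex_of_real t powr (s + 1) *
      of_real (((1 + exp (- t)) / (2 * (1 - exp (- t))) - 1 / t) / t\<^sup>2))"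
  have nz: "s - 1 \<noteq> 0" "s \<noteq> 0" "s + 1 \<noteq> 0" using s by (auto simp: complex_eq_iff)
  have p\<sigma>: "complex_of_real t powr (\<sigma> + of_real r) = of_real (t powr (Re s + r))" if "t > 0" for t r
    using that by (simp add: \<sigma>_def powr_of_real[symmetric])

  have sumI: "(\<lambda>n. Gamma (z + 2) * (zeta_piece n z / C z)) sums (Gamma (z + 2) * (zeta_numerator z / C z))"
    if "-1 < Re z" for z
    by (intro sums_mult sums_divide sums_zeta_piece that)
  \<comment> \<open>First evaluation of the integral of \<open>\<Phi>\<close>: the sum over unit
    intervals.\<close>
  have "has_set_integral (\<lambda>t. \<Sum>n. complex_of_real t powr (s + 1) * of_real (piece_Laplace n t))
      (\<Sum>n. Gamma (s + 2) * (zeta_piece n s / C s)) {0<..}"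
  proof (rule has_set_integral_suminf(1))
    show "has_set_integral (\<lambda>t. of_real t powr (s + 1) * of_real (piece_Laplace n t))
      (Gamma (s + 2) * (zeta_piece n s / C s)) {0<..}" for n
      unfolding C_def by (rule has_set_integral_Mellin_piece_Laplace[OF s])
    have n: "norm (complex_of_real t powr (s + 1) * of_real (piece_Laplace n t)) =
        t powr (Re s + 1) * piece_Laplace n t" if "t > 0" for t n
      using piece_Laplace_nonneg[OF that, of n] that by (simp add: norm_mult norm_of_real_powr)
    show "summable (\<lambda>n. norm (complex_of_real t powr (s + 1) * of_real (piece_Laplace n t)))"
      if "t \<in> {0<..}" for t
      using that sums_piece_Laplace[of t] by (auto simp: n sums_iff intro!: summable_mult)
    show "has_set_integral (\<lambda>t. norm (complex_of_real t powr (s + 1) * of_real (piece_Laplace n t)))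
        (Re (Gamma (\<sigma> + 2) * (zeta_piece n \<sigma> / C \<sigma>))) {0<..}" for n
    proof -
      have "has_set_integral (\<lambda>t. Re (of_real t powr (\<sigma> + 1) * of_real (piece_Laplace n t)))
        (Re (Gamma (\<sigma> + 2) * (zeta_piece n \<sigma> / C \<sigma>))) {0<..}"
        unfolding C_def by (intro has_set_integral_Re has_set_integral_Mellin_piece_Laplace \<sigma>)
      also have "?this \<longleftrightarrow> ?thesis"
        using p\<sigma>[of _ 1] by (intro has_set_integral_cong) (auto simp: n)
      finally show ?thesis .
    qed
    show "summable (\<lambda>n. Re (Gamma (\<sigma> + 2) * (zeta_piece n \<sigma> / C \<sigma>)))"
      by (intro summable_Re sums_summable[OF sumI] \<sigma>)
  qed
  also have "?this \<longleftrightarrow> has_set_integral \<Phi> (Gamma (s + 2) * (zeta_numerator s / C s)) {0<..}"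
  proof (rule has_set_integral_cong)
    fix t :: real assume "t \<in> {0<..}"
    hence "(\<lambda>n. complex_of_real t powr (s + 1) * of_real (piece_Laplace n t)) sums \<Phi> t"
      unfolding \<Phi>_def by (intro sums_mult sums_of_real sums_piece_Laplace) auto
    thus "(\<Sum>n. complex_of_real t powr (s + 1) * of_real (piece_Laplace n t)) = \<Phi> t"
      by (rule sums_unique[symmetric])
  next
    show "(\<Sum>n. Gamma (s + 2) * (zeta_piece n s / C s)) = Gamma (s + 2) * (zeta_numerator s / C s)"
      by (rule sums_unique[symmetric, OF sumI[OF s(1)]])
  qed
  finally have int1: "has_set_integral \<Phi> (Gamma (s + 2) * (zeta_numerator s / C s)) {0<..}" .

  have apow: "of_real (a k) powr (z - 1) = complex_of_real (2 * pi) powr (z - 1) * of_nat (Suc k) powr (- (1 - z))"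
    for k and z :: complex
    unfolding a_def of_real_mult[of "2 * pi"] by (subst powr_times_real_left) auto
  have sumJ: "(\<lambda>k. B z * of_real (a k) powr (z - 1)) sums
      (B z * (of_real (2 * pi) powr (z - 1) * dirichlet_zeta (1 - z)))" if "Re z < 0" for z
  proof -
    have "summable (\<lambda>k. of_nat (Suc k) powr (- (1 - z)))"
      by (rule summable_norm_cancel, rule summable_dirichlet_zeta) (use that in auto)
    hence "(\<lambda>k. of_nat (Suc k) powr (- (1 - z))) sums dirichlet_zeta (1 - z)"
      by (simp add: dirichlet_zeta_def sums_iff)
    thus ?thesis unfolding apow by (intro sums_mult)
  qed
  \<comment> \<open>Second evaluation: the sum over the poles at plus or minus
    \<open>2 * pi * \<i> * (k + 1)\<close>, whose distances \<open>a k\<close> produce the Dirichlet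
    series at \<open>1 - s\<close>.\<close>
  have "has_set_integral (\<lambda>t. \<Sum>k. complex_of_real t powr s * of_real (2 / (t\<^sup>2 + (a k)\<^sup>2)))
      (\<Sum>k. B s * of_real (a k) powr (s - 1)) {0<..}"
  proof (rule has_set_integral_suminf(1))
    show "has_set_integral (\<lambda>t. complex_of_real t powr s * of_real (2 / (t\<^sup>2 + (a k)\<^sup>2)))
        (B s * of_real (a k) powr (s - 1)) {0<..}" for k
      unfolding B_def by (rule has_set_integral_powr_over_square_plus_square[OF s a])
    have n: "norm (complex_of_real t powr s * of_real (2 / (t\<^sup>2 + (a k)\<^sup>2))) =
        t powr Re s * (2 / (t\<^sup>2 + (a k)\<^sup>2))" if "t > 0" for t k
      unfolding norm_mult norm_of_real using that by (simp add: norm_of_real_powr)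
    show "summable (\<lambda>k. norm (complex_of_real t powr s * of_real (2 / (t\<^sup>2 + (a k)\<^sup>2))))"
      if "t \<in> {0<..}" for t
    proof -
      have t: "t > 0" using that by simp
      have "summable (\<lambda>k. t powr Re s * (1 / t * (2 * t / (t\<^sup>2 + (a k)\<^sup>2))))"
        unfolding a_def by (intro summable_mult sums_summable[OF coth_partial_fractions[OF t]])
      thus ?thesis unfolding n[OF t] using t by simp
    qed
    show "has_set_integral (\<lambda>t. norm (complex_of_real t powr s * of_real (2 / (t\<^sup>2 + (a k)\<^sup>2))))
        (Re (B \<sigma> * of_real (a k) powr (\<sigma> - 1))) {0<..}" for k
    proof -
      have "has_set_integral (\<lambda>t. Re (complex_of_real t powr \<sigma> * of_real (2 / (t\<^sup>2 + (a k)\<^sup>2))))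
        (Re (B \<sigma> * of_real (a k) powr (\<sigma> - 1))) {0<..}"
        unfolding B_def
        by (intro has_set_integral_Re has_set_integral_powr_over_square_plus_square \<sigma> a)
      also have "?this \<longleftrightarrow> ?thesis"
        using p\<sigma>[of _ 0] by (intro has_set_integral_cong refl) (simp add: n del: of_real_divide)
      finally show ?thesis .
    qed
    show "summable (\<lambda>k. Re (B \<sigma> * of_real (a k) powr (\<sigma> - 1)))"
      by (intro summable_Re sums_summable[OF sumJ] \<sigma>)
  qed
  also have "?this \<longleftrightarrow> has_set_integral \<Phi>
      (B s * (of_real (2 * pi) powr (s - 1) * dirichlet_zeta (1 - s))) {0<..}"
  proof (rule has_set_integral_cong)
    fix t :: real assume "t \<in> {0<..}"
    hence t: "t > 0" by simp
    have "(\<lambda>k. complex_of_real t powr (s + 1) * of_real (2 * t / (t\<^sup>2 + (a k)\<^sup>2) / t\<^sup>2)) sums \<Phi> t"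
      unfolding \<Phi>_def a_def
      by (intro sums_mult sums_of_real sums_divide coth_partial_fractions t)
    also have "(\<lambda>k. complex_of_real t powr (s + 1) * of_real (2 * t / (t\<^sup>2 + (a k)\<^sup>2) / t\<^sup>2)) =
        (\<lambda>k. complex_of_real t powr s * of_real (2 / (t\<^sup>2 + (a k)\<^sup>2)))"
    proof
      fix k
      have "complex_of_real t powr (s + 1) = of_real t powr s * of_real t"
        using t by (simp add: powr_add)
      moreover have "t * (2 * t / (t\<^sup>2 + (a k)\<^sup>2) / t\<^sup>2) = 2 / (t\<^sup>2 + (a k)\<^sup>2)"
        using t by (simp add: power2_eq_square)
      ultimately show "complex_of_real t powr (s + 1) * of_real (2 * t / (t\<^sup>2 + (a k)\<^sup>2) / t\<^sup>2) =
          of_real t powr s * of_real (2 / (t\<^sup>2 + (a k)\<^sup>2))"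
        by (metis mult.assoc of_real_mult)
    qed
    finally show "(\<Sum>k. complex_of_real t powr s * of_real (2 / (t\<^sup>2 + (a k)\<^sup>2))) = \<Phi> t"
      by (rule sums_unique[symmetric])
  next
    show "(\<Sum>k. B s * of_real (a k) powr (s - 1)) =
        B s * (of_real (2 * pi) powr (s - 1) * dirichlet_zeta (1 - s))"
      by (rule sums_unique[symmetric, OF sumJ[OF s(2)]])
  qed
  finally have int2: "has_set_integral \<Phi>
      (B s * (of_real (2 * pi) powr (s - 1) * dirichlet_zeta (1 - s))) {0<..}" .

  have s1: "s + 1 \<notin> \<int>\<^sub>\<le>\<^sub>0" using s by (auto elim!: nonpos_Ints_cases simp: complex_eq_iff)
  have G2: "Gamma (s + 2) = (s + 1) * Gamma (s + 1)"
    using Gamma_plus1[OF s1] by (simp add: add.assoc)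
  have G1: "Gamma (1 - s) = - s * Gamma (- s)"
  proof -
    have "- s \<notin> \<int>\<^sub>\<le>\<^sub>0" using s by (auto elim!: nonpos_Ints_cases simp: complex_eq_iff)
    thus ?thesis using Gamma_plus1[of "- s"] by simp
  qed
  have G0: "Gamma (s + 1) \<noteq> 0"
    using s1 by (simp add: Gamma_eq_zero_iff)
  have "Gamma (s + 2) * (zeta_numerator s / C s) =
      B s * (of_real (2 * pi) powr (s - 1) * dirichlet_zeta (1 - s))"
    using int1 int2 by (simp add: has_set_integral_def)
  hence "Gamma (s + 1) * (zeta_numerator s / ((s - 1) * s)) =
      Gamma (s + 1) * (- 2 * sin (of_real pi * s / 2) * Gamma (- s) *
        (of_real (2 * pi) powr (s - 1) * dirichlet_zeta (1 - s)))"
    unfolding G2 C_def B_def using nz by (simp add: mult_ac)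
  hence "zeta_numerator s / ((s - 1) * s) = - 2 * sin (of_real pi * s / 2) * Gamma (- s) *
        (of_real (2 * pi) powr (s - 1) * dirichlet_zeta (1 - s))"
    using G0 mult_left_cancel by blast
  hence "zeta_numerator s = (s - 1) * s * (- 2 * sin (of_real pi * s / 2) * Gamma (- s) *
        (of_real (2 * pi) powr (s - 1) * dirichlet_zeta (1 - s)))"
    using nz by (metis divide_eq_eq mult.commute mult_eq_0_iff)
  thus ?thesis unfolding G1 by (simp add: mult_ac)
qed

section \<open>Continuation to the plane and location of the zeros\<close>

lemma holomorphic_dirichlet_zeta: "dirichlet_zeta holomorphic_on {s. Re s > 1}"
proof -
  have "(\<lambda>s. zeta_numerator s / (s - 1)) holomorphic_on {s. Re s > 1}"
    by (intro holomorphic_intros holomorphic_on_subset[OF holomorphic_zeta_numerator]) auto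
  thus ?thesis
    by (rule holomorphic_transform) (auto simp: zeta_numerator_eq_dirichlet)
qed

lemma Re_pos_not_nonpos_Int: "Re z > 0 \<Longrightarrow> z \<notin> \<int>\<^sub>\<le>\<^sub>0"
  by (auto elim!: nonpos_Ints_cases)

text \<open>The right-hand side of the functional equation. For Re s < 0 the argument
  \<open>1 - s\<close> lies where the Dirichlet series converges, so the formula itself is the
  continuation to the left.\<close>

definition zeta_reflected :: "complex \<Rightarrow> complex" where
  "zeta_reflected s = 2 * of_real (2 * pi) powr (s - 1) * sin (of_real pi * s / 2) *
     Gamma (1 - s) * dirichlet_zeta (1 - s)"

lemma holomorphic_zeta_reflected: "zeta_reflected holomorphic_on {s. Re s < 0}"
proof -
  have "(dirichlet_zeta \<circ> (\<lambda>s. 1 - s)) holomorphic_on {s. Re s < 0}"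
    by (intro holomorphic_on_compose holomorphic_intros holomorphic_on_subset[OF holomorphic_dirichlet_zeta])
       auto
  hence 1: "(\<lambda>s. dirichlet_zeta (1 - s)) holomorphic_on {s. Re s < 0}" by (simp add: o_def)
  have 2: "(\<lambda>s. Gamma (1 - s)) holomorphic_on {s. Re s < 0}"
    by (intro holomorphic_intros) (auto intro!: Re_pos_not_nonpos_Int)
  have 3: "(\<lambda>s. 2 * of_real (2 * pi) powr (s - 1) * sin (of_real pi * s / 2)) holomorphic_on {s. Re s < 0}"
    by (intro holomorphic_intros) auto
  show ?thesis unfolding zeta_reflected_def
    by (rule holomorphic_on_mult[OF holomorphic_on_mult[OF 3 2] 1])
qed

text \<open>Gluing the two formulas along -1 < Re s < 0 exhibits a witness for the choice in the
  definition. The punctured plane is connected, so the identity theorem makes any chosen function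
  agree with this witness.\<close>

lemma riemann_zeta_spec:
  "riemann_zeta holomorphic_on (- {1}) \<and> (\<forall>s. Re s > 1 \<longrightarrow> riemann_zeta s = dirichlet_zeta s)"
  and riemann_zeta_eq_numerator: "Re s > -1 \<Longrightarrow> s \<noteq> 1 \<Longrightarrow> riemann_zeta s = zeta_numerator s / (s - 1)"
  and riemann_zeta_eq_reflected: "Re s < 0 \<Longrightarrow> riemann_zeta s = zeta_reflected s"
proof -
  let ?A = "{s. Re s > -1} - {1 :: complex}" and ?B = "{s. Re s < 0}"
  define g where "g = (\<lambda>s. if s \<in> ?A then zeta_numerator s / (s - 1) else zeta_reflected s)"
  have agree: "zeta_numerator s / (s - 1) = zeta_reflected s" if "s \<in> ?A" "s \<in> ?B" for s
    using that zeta_functional_equation_strip[of s] by (auto simp: zeta_reflected_def)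
  have "g holomorphic_on ?A \<union> ?B"
    unfolding g_def
  proof (intro holomorphic_on_If_Un agree)
    show "(\<lambda>s. zeta_numerator s / (s - 1)) holomorphic_on ?A"
      by (intro holomorphic_intros holomorphic_on_subset[OF holomorphic_zeta_numerator]) auto
    show "open ?A" by (intro open_delete open_halfspace_Re_gt)
    show "open ?B" by (rule open_halfspace_Re_lt)
  qed (auto intro: holomorphic_zeta_reflected)
  also have "?A \<union> ?B = - {1}" by auto
  finally have g: "g holomorphic_on - {1}" .
  have gd: "g s = dirichlet_zeta s" if "Re s > 1" for s
    using that zeta_numerator_eq_dirichlet[OF that] by (auto simp: g_def)
  have "g holomorphic_on (- {1}) \<and> (\<forall>s. Re s > 1 \<longrightarrow> g s = (\<Sum>n. of_nat (Suc n) powr (- s)))"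
    using g gd by (auto simp: dirichlet_zeta_def)
  from someI[of "\<lambda>g. g holomorphic_on (- {1}) \<and>
      (\<forall>s. Re s > 1 \<longrightarrow> g s = (\<Sum>n. of_nat (Suc n) powr (- s)))", OF this]
  show spec: "riemann_zeta holomorphic_on (- {1}) \<and> (\<forall>s. Re s > 1 \<longrightarrow> riemann_zeta s = dirichlet_zeta s)"
    unfolding riemann_zeta_def dirichlet_zeta_def .
  have eq: "riemann_zeta s = g s" if "s \<noteq> 1" for s
  proof (rule analytic_continuation_open[of "{s. Re s > 1}" "- {1}" riemann_zeta g s])
    show "connected (- {1 :: complex})"
      by (intro path_connected_imp_connected path_connected_punctured_universe) simp
    show "{s. 1 < Re s} \<noteq> {}" by (auto intro!: exI[of _ 2])
  qed (use spec g gd that in \<open>auto simp: open_halfspace_Re_gt\<close>)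
  show "riemann_zeta s = zeta_numerator s / (s - 1)" if "Re s > -1" "s \<noteq> 1"
    using eq[of s] that by (simp add: g_def)
  show "riemann_zeta s = zeta_reflected s" if "Re s < 0"
  proof -
    have "s \<noteq> 1" using that by auto
    thus ?thesis using eq[of s] agree[of s] that by (auto simp: g_def)
  qed
qed

text \<open>To the left of the strip no factor of the reflected formula vanishes off the real axis:
  the sine has only real zeros, Gamma has none, and the Dirichlet series has none for Re >
  1.\<close>

lemma upper_zeta_zero_location:
  assumes "riemann_zeta z = 0" "Im z > 0"
  shows "0 \<le> Re z" "Re z \<le> 1" "Im z > 1 / 2"
proof -
  have z1: "z \<noteq> 1" using assms(2) by auto
  show 0: "0 \<le> Re z"
  proof (rule ccontr)
    assume "\<not> 0 \<le> Re z"
    hence neg: "Re z < 0" by simp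
    have "sin (of_real pi * z / 2) \<noteq> 0"
    proof
      assume "sin (of_real pi * z / 2) = 0"
      then obtain n :: int where "of_real pi * z / 2 = complex_of_real (of_int n * pi)"
        by (auto simp: sin_eq_0)
      hence "Im (of_real pi * z / 2) = 0" by simp
      thus False using assms(2) by simp
    qed
    moreover have "Gamma (1 - z) \<noteq> 0"
      using neg by (simp add: Gamma_eq_zero_iff Re_pos_not_nonpos_Int)
    moreover have "dirichlet_zeta (1 - z) \<noteq> 0"
      using neg by (intro dirichlet_zeta_nonzero) auto
    ultimately have "zeta_reflected z \<noteq> 0"
      by (auto simp: zeta_reflected_def)
    thus False using riemann_zeta_eq_reflected[OF neg] assms(1) by simp
  qed
  show 1: "Re z \<le> 1"
    using riemann_zeta_spec dirichlet_zeta_nonzero[of z] assms(1) by (cases "Re z > 1") auto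
  have "zeta_numerator z = 0"
    using riemann_zeta_eq_numerator[of z] 0 z1 assms(1) by simp
  thus "Im z > 1 / 2"
    using zeta_numerator_nonzero_near_real_axis[of z] 0 1 assms(2) by force
qed

text \<open>The factor \<open>w - 1\<close> does not vanish near \<open>z\<close>. Multiplicities
  are prescribed for \<open>riemann_zeta\<close>, while Jensen's inequality needs
  \<open>zeta_numerator\<close>, since low discs contain the pole at 1.\<close>

lemma zorder_zeta_numerator:
  assumes "Re z > -1" "z \<noteq> 1"
  shows "zorder zeta_numerator z = zorder riemann_zeta z"
proof -
  define S where "S = {s. Re s > -1}"
  have S: "open S" "connected S"
    unfolding S_def by (auto simp: open_halfspace_Re_gt convex_halfspace_Re_gt intro!: convex_connected)
  have zS: "z \<in> S" using assms by (simp add: S_def)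
  have "zeta_numerator 2 = dirichlet_zeta 2"
    using zeta_numerator_eq_dirichlet[of 2] by simp
  hence nz: "\<exists>w\<in>S. zeta_numerator w \<noteq> 0"
    using dirichlet_zeta_nonzero[of 2] by (intro bexI[of _ 2]) (auto simp: S_def)
  have hol: "zeta_numerator holomorphic_on S" using holomorphic_zeta_numerator by (simp add: S_def)
  note ex = zorder_exist_zero[OF hol S zS nz]
  obtain r where r: "r > 0" "cball z r \<subseteq> S" "zor_poly zeta_numerator z holomorphic_on cball z r"
    and e: "\<And>w. w \<in> cball z r \<Longrightarrow> zeta_numerator w =
      zor_poly zeta_numerator z w * (w - z) ^ nat (zorder zeta_numerator z) \<and> zor_poly zeta_numerator z w \<noteq> 0"
    using conjunct2[OF ex] by blast
  have n0: "zorder zeta_numerator z \<ge> 0"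
    using conjunct1[OF ex] by (simp split: if_splits)
  let ?g = "\<lambda>w. zor_poly zeta_numerator z w / (w - 1)"
  have "zorder riemann_zeta z = zorder zeta_numerator z"
  proof (rule zorder_eqI[of "ball z r - {1}" z ?g])
    show "?g holomorphic_on ball z r - {1}"
      by (intro holomorphic_intros holomorphic_on_subset[OF r(3)]) auto
    show "?g z \<noteq> 0" using e[of z] r(1) assms(2) by simp
    fix w assume w: "w \<in> ball z r - {1}" "w \<noteq> z"
    hence "w \<in> S" using r(2) by (auto simp: subset_iff)
    hence "riemann_zeta w = zeta_numerator w / (w - 1)"
      using w riemann_zeta_eq_numerator[of w] by (auto simp: S_def)
    also have "\<dots> = ?g w * (w - z) ^ nat (zorder zeta_numerator z)" using e[of w] w by simp
    finally show "riemann_zeta w = ?g w * (w - z) powi zorder zeta_numerator z"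
      using n0 by (simp add: power_int_def)
  qed (use r(1) assms(2) in auto)
  thus ?thesis by simp
qed

section \<open>Jensen's inequality\<close>

text \<open>The local factorization lives on a small disc around \<open>a\<close>; away from
  \<open>a\<close> one can simply divide, and both cofactors agree on the overlap.\<close>

lemma holomorphic_factor_power:
  assumes f: "f holomorphic_on S" and S: "open S" "connected S" "a \<in> S" and nz: "\<exists>w\<in>S. f w \<noteq> 0"
  shows "\<exists>g. g holomorphic_on S \<and> (\<forall>w\<in>S. f w = (w - a) ^ nat (zorder f a) * g w)"
proof -
  define n where "n = nat (zorder f a)"
  define g0 where "g0 = zor_poly f a"
  obtain r where r: "r > 0" "cball a r \<subseteq> S" "g0 holomorphic_on cball a r"
    and e: "\<And>w. w \<in> cball a r \<Longrightarrow> f w = g0 w * (w - a) ^ n"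
    using zorder_exist_zero[OF f S nz] unfolding n_def g0_def by blast
  define g where "g = (\<lambda>w. if w \<in> S - {a} then f w / (w - a) ^ n else g0 w)"
  have "g holomorphic_on (S - {a}) \<union> ball a r"
    unfolding g_def
  proof (intro holomorphic_on_If_Un)
    show "(\<lambda>w. f w / (w - a) ^ n) holomorphic_on S - {a}"
      by (intro holomorphic_intros holomorphic_on_subset[OF f]) auto
    show "g0 holomorphic_on ball a r"
      using r(3) by (rule holomorphic_on_subset) auto
    show "open (S - {a})" using S by (intro open_delete)
    show "f z / (z - a) ^ n = g0 z" if "z \<in> S - {a}" "z \<in> ball a r" for z
      using that e[of z] by auto
  qed auto
  moreover have "(S - {a}) \<union> ball a r = S"
    using r S(3) ball_subset_cball[of a r] by auto
  moreover have "f w = (w - a) ^ n * g w" if "w \<in> S" for w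
    using that e[of w] r(1) by (auto simp: g_def mult.commute)
  ultimately show ?thesis unfolding n_def by auto
qed

lemma holomorphic_factor_prod:
  assumes "finite T" and f: "f holomorphic_on S" and S: "open S"
    and fac: "\<And>a. a \<in> T \<Longrightarrow> \<exists>g. g holomorphic_on S \<and> (\<forall>w\<in>S. f w = (w - a) ^ m a * g w)"
  shows "\<exists>h. h holomorphic_on S \<and> (\<forall>w\<in>S. f w = (\<Prod>a\<in>T. (w - a) ^ m a) * h w)"
  using assms(1) fac
proof (induction T rule: finite_induct)
  case empty
  show ?case using f by (intro exI[of _ f]) auto
next
  case (insert b T)
  define P where "P = (\<lambda>w. \<Prod>a\<in>T. (w - a) ^ m a)"
  obtain h where h: "h holomorphic_on S" "\<And>w. w \<in> S \<Longrightarrow> f w = P w * h w"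
    using insert.IH insert.prems unfolding P_def by blast
  obtain g where g: "g holomorphic_on S" "\<And>w. w \<in> S \<Longrightarrow> f w = (w - b) ^ m b * g w"
    using insert.prems[of b] by blast
  have P: "P holomorphic_on A" for A unfolding P_def by (intro holomorphic_intros)
  have Pb: "P b \<noteq> 0" using insert.hyps by (auto simp: P_def)
  \<comment> \<open>Off \<open>b\<close> the old cofactor is divided by the new power; near
    \<open>b\<close> the single-point cofactor \<open>g\<close> is divided by the other factors,
    which do not vanish there.\<close>
  define h' where "h' = (\<lambda>w. if w \<in> S - {b} then h w / (w - b) ^ m b else g w / P w)"
  let ?B = "{w \<in> S. P w \<noteq> 0}"
  have "h' holomorphic_on (S - {b}) \<union> ?B"
    unfolding h'_def
  proof (intro holomorphic_on_If_Un)
    show "(\<lambda>w. h w / (w - b) ^ m b) holomorphic_on S - {b}"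
      by (intro holomorphic_intros holomorphic_on_subset[OF h(1)]) auto
    show "(\<lambda>w. g w / P w) holomorphic_on ?B"
      by (intro holomorphic_on_divide P holomorphic_on_subset[OF g(1)]) auto
    show "open (S - {b})" using S by (intro open_delete)
    have "open (S \<inter> P -` (- {0}))"
      using continuous_open_preimage[OF holomorphic_on_imp_continuous_on[OF P] S, of "- {0}"] by auto
    moreover have "S \<inter> P -` (- {0}) = ?B" by auto
    ultimately show "open ?B" by simp
    show "h z / (z - b) ^ m b = g z / P z" if "z \<in> S - {b}" "z \<in> ?B" for z
      using that h(2)[of z] g(2)[of z] by (auto simp: field_simps)
  qed
  moreover have "S \<subseteq> (S - {b}) \<union> ?B" using Pb by auto
  ultimately have "h' holomorphic_on S" using holomorphic_on_subset by blast
  moreover have "f w = (\<Prod>a\<in>insert b T. (w - a) ^ m a) * h' w" if w: "w \<in> S" for w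
  proof -
    have "(\<Prod>a\<in>insert b T. (w - a) ^ m a) = (w - b) ^ m b * P w"
      using insert.hyps by (simp add: P_def)
    thus ?thesis using g(2)[OF w] h(2)[OF w] w Pb by (cases "w = b") (auto simp: h'_def)
  qed
  ultimately show ?case by blast
qed

text \<open>Dividing \<open>f\<close> by the Blaschke factors of its zeros leaves its modulus on the circle unchanged.\<close>
lemma Jensen_bound:
  assumes T: "finite T" "T \<subseteq> cball c r" and r: "0 < r" "r < R"
    and f: "f holomorphic_on S" and S: "open S" "connected S" "cball c R \<subseteq> S" and fc: "f c \<noteq> 0"
    and M: "\<And>w. w \<in> sphere c R \<Longrightarrow> norm (f w) \<le> M"
  shows "norm (f c) \<le> M * (r / R) ^ (\<Sum>a\<in>T. nat (zorder f a))"
proof -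
  define m where "m = (\<lambda>a. nat (zorder f a))"
  have R: "R > 0" using r by linarith
  have cS: "c \<in> S" using S(3) R by auto
  have "T \<subseteq> S" using T(2) S(3) r by (auto simp: subset_iff)
  then obtain h where h: "h holomorphic_on S" "\<And>w. w \<in> S \<Longrightarrow> f w = (\<Prod>a\<in>T. (w - a) ^ m a) * h w"
    using holomorphic_factor_prod[OF T(1) f S(1), of m] holomorphic_factor_power[OF f S(1,2)] fc cS
    unfolding m_def by blast
  \<comment> \<open>Each factor \<open>w - a\<close> is replaced by one with the same modulus on the
    circle and value \<open>R\<close> at the centre. The maximum principle for \<open>F\<close> then
    bounds \<open>norm (h c) * R ^ sum m T\<close>.\<close>
  define F where "F = (\<lambda>w. h w * (\<Prod>a\<in>T. ((of_real (R\<^sup>2) - cnj (a - c) * (w - c)) / of_real R) ^ m a))"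
  have F: "F holomorphic_on S" unfolding F_def using R by (intro holomorphic_intros h(1)) auto
  have "norm (F w) \<le> M" if w: "w \<in> sphere c R" for w
  proof -
    have wS: "w \<in> S" using S(3) w by auto
    have nw: "norm (w - c) = R" using w by (simp add: dist_norm norm_minus_commute)
    have "norm ((of_real (R\<^sup>2) - cnj (a - c) * (w - c)) / of_real R) = norm (w - a)" for a
    proof -
      have "complex_of_real (R\<^sup>2) = (w - c) * cnj (w - c)"
        using nw complex_norm_square[of "w - c"] by simp
      hence "of_real (R\<^sup>2) - cnj (a - c) * (w - c) = (w - c) * cnj (w - a)"
        by (simp add: algebra_simps)
      thus ?thesis using R nw by (simp add: norm_mult norm_divide del: complex_cnj_diff)
    qed
    hence "norm (F w) = norm (f w)"
      unfolding F_def h(2)[OF wS] norm_mult prod_norm[symmetric] norm_power by simp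
    thus ?thesis using M[OF w] by simp
  qed
  moreover have "F holomorphic_on ball c R" "F holomorphic_on cball c R"
    by (rule holomorphic_on_subset[OF F subset_trans[OF ball_subset_cball S(3)]],
        rule holomorphic_on_subset[OF F S(3)])
  ultimately have "norm (F c) \<le> M"
    using R maximum_modulus_frontier[of F "cball c R" M c]
    by (simp add: holomorphic_on_imp_continuous_on)
  moreover have "norm (F c) = norm (h c) * R ^ sum m T"
    using R by (simp add: F_def norm_mult norm_power norm_divide power2_eq_square power_sum prod_norm[symmetric])
  moreover have "norm (f c) \<le> norm (h c) * r ^ sum m T"
  proof -
    have "norm (f c) = norm (h c) * (\<Prod>a\<in>T. norm (c - a) ^ m a)"
      using h(2)[OF cS] by (simp add: norm_mult norm_power prod_norm[symmetric] mult.commute)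
    also have "\<dots> \<le> norm (h c) * (\<Prod>a\<in>T. r ^ m a)"
      using T(2) by (intro mult_left_mono prod_mono conjI power_mono) (auto simp: dist_norm)
    finally show ?thesis by (simp add: power_sum)
  qed
  ultimately have "norm (h c) * R ^ sum m T \<le> M" "norm (f c) \<le> norm (h c) * r ^ sum m T" by simp_all
  hence "norm (f c) \<le> (norm (h c) * R ^ sum m T) * (r / R) ^ sum m T"
    using R by (simp add: power_divide)
  also have "\<dots> \<le> M * (r / R) ^ sum m T"
    using \<open>norm (h c) * R ^ sum m T \<le> M\<close> r by (intro mult_right_mono) auto
  finally show ?thesis by (simp add: m_def)
qed

section \<open>Counting zeros and the main identity\<close>

lemma zeta_numerator_polynomial_bound:
  obtains K where "K > 0" "\<And>w. Re w \<ge> - 1 / 2 \<Longrightarrow> norm (zeta_numerator w) \<le> K * (norm w + 1) ^ 3"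
proof
  define Z where "Z = (\<Sum>n. real (Suc n) powr (- (- 1 / 2 + 2)))"
  have Z: "Z \<ge> 0" unfolding Z_def by (intro suminf_nonneg summable_Suc_powr) auto
  thus "1 + Z > 0" by simp
  fix w :: complex assume w: "Re w \<ge> - 1 / 2"
  let ?x = "norm w + 1"
  have "norm (zeta_numerator w) \<le> norm ((w + 1) / 2) + norm (zeta_numerator w - (w + 1) / 2)"
    using norm_triangle_ineq[of "(w + 1) / 2" "zeta_numerator w - (w + 1) / 2"] by simp
  moreover have "norm (zeta_numerator w - (w + 1) / 2) \<le> norm ((w - 1) * w * (w + 1)) / 8 * Z"
    unfolding Z_def using w by (intro norm_zeta_numerator_diff_le(2)) auto
  moreover have "norm ((w - 1) * w * (w + 1)) / 8 * Z \<le> ?x ^ 3 * Z"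
  proof (rule mult_right_mono[OF _ Z])
    have "norm ((w - 1) * w * (w + 1)) \<le> ?x * ?x * ?x"
      unfolding norm_mult using norm_triangle_ineq4[of w 1] norm_triangle_ineq[of w 1]
      by (intro mult_mono) auto
    moreover have "0 \<le> ?x * ?x * ?x" by simp
    ultimately show "norm ((w - 1) * w * (w + 1)) / 8 \<le> ?x ^ 3" unfolding power3_eq_cube by linarith
  qed
  moreover have "norm ((w + 1) / 2) \<le> ?x ^ 3"
  proof -
    have "norm ((w + 1) / 2) = norm (w + 1) / 2" by (simp add: norm_divide)
    also have "\<dots> \<le> ?x ^ 1"
      using norm_triangle_ineq[of w 1] norm_ge_zero[of w] unfolding norm_one power_one_right by linarith
    also have "?x ^ 1 \<le> ?x ^ 3" by (intro power_increasing) auto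
    finally show ?thesis .
  qed
  ultimately show "norm (zeta_numerator w) \<le> (1 + Z) * ?x ^ 3"
    unfolding distrib_right mult_1_left mult.commute[of Z] by linarith
qed

text \<open>On Re s = 2 the terms after the first sum to at most \<open>pi\<^sup>2 / 6 - 1\<close>
  in norm, and \<open>|s - 1| \<ge> 1\<close>. This bounds the centre value in Jensen's inequality
  below, independently of the height.\<close>

lemma norm_zeta_numerator_ge:
  assumes "Re s = 2"
  shows "norm (zeta_numerator s) \<ge> 2 - pi\<^sup>2 / 6"
proof -
  let ?a = "\<lambda>n. of_nat (Suc n) powr (- s)"
  have sq: "(\<lambda>n. norm (?a n)) = (\<lambda>n. 1 / (real n + 1)\<^sup>2)"
  proof
    fix n
    have "norm (?a n) = real (Suc n) powr (- 2)"
      using norm_powr_real_powr[of "of_nat (Suc n)" "- s"] assms by (simp del: of_nat_Suc)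
    thus "norm (?a n) = 1 / (real n + 1)\<^sup>2"
      by (simp add: powr_minus divide_inverse add.commute)
  qed
  have n: "(\<lambda>n. norm (?a n)) sums (pi\<^sup>2 / 6)"
    unfolding sq using inverse_squares_sums by (simp add: add.commute)
  hence n': "(\<lambda>n. norm (?a (Suc n))) sums (pi\<^sup>2 / 6 - 1)"
    by (subst sums_Suc_iff) simp
  have sa: "summable ?a" by (rule summable_norm_cancel[OF sums_summable[OF n]])
  have "dirichlet_zeta s = (\<Sum>n. ?a (Suc n)) + 1"
    using suminf_split_head[OF sa] by (simp add: dirichlet_zeta_def)
  hence "1 = norm (dirichlet_zeta s - (\<Sum>n. ?a (Suc n)))" by simp
  also have "\<dots> \<le> norm (dirichlet_zeta s) + norm (\<Sum>n. ?a (Suc n))" by (rule norm_triangle_ineq4)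
  finally have "1 \<le> norm (dirichlet_zeta s) + norm (\<Sum>n. ?a (Suc n))" .
  moreover have "norm (\<Sum>n. ?a (Suc n)) \<le> pi\<^sup>2 / 6 - 1"
    using summable_norm[OF sums_summable[OF n']] n' by (simp add: sums_iff)
  ultimately have "2 - pi\<^sup>2 / 6 \<le> 1 * norm (dirichlet_zeta s)" by simp
  also have "\<dots> \<le> norm (s - 1) * norm (dirichlet_zeta s)"
    using abs_Re_le_cmod[of "s - 1"] assms by (intro mult_right_mono) auto
  also have "\<dots> = norm (zeta_numerator s)"
    using zeta_numerator_eq_dirichlet[of s] assms by (simp add: norm_mult)
  finally show ?thesis .
qed

text \<open>Jensen's inequality around 2 + i(k + 1/2) gives a logarithmic count. It is weakened to
  an arbitrarily small power, the form in which it is summed over \<open>k\<close>.\<close>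

lemma card_upper_zeta_zeros_window:
  assumes \<rho>: "upper_zeta_zeros \<rho>" and \<epsilon>: "\<epsilon> > 0"
  obtains D where "D \<ge> 0"
    "\<And>k I. finite I \<Longrightarrow> (\<And>n. n \<in> I \<Longrightarrow> real k \<le> Im (\<rho> n) \<and> Im (\<rho> n) \<le> real k + 1) \<Longrightarrow>
       real (card I) \<le> D * (real k + 1) powr \<epsilon>"
proof -
  obtain K where K: "K > 0" "\<And>w. Re w \<ge> - 1 / 2 \<Longrightarrow> norm (zeta_numerator w) \<le> K * (norm w + 1) ^ 3"
    using zeta_numerator_polynomial_bound by blast
  define \<delta> where "\<delta> = 2 - pi\<^sup>2 / 6"
  have \<delta>: "\<delta> > 0"
  proof -
    have "pi\<^sup>2 < 3.2\<^sup>2" using pi_approx by (intro power_strict_mono) auto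
    thus ?thesis by (simp add: \<delta>_def power2_eq_square)
  qed
  \<comment> \<open>The radii 2.1 and 2.4 have ratio 7/8, so each zero costs a factor 8/7.\<close>
  define q where "q = ln (8 / 7 :: real)"
  have q: "q > 0" by (simp add: q_def)
  define D where "D = (\<bar>ln (K / \<delta>)\<bar> + 3 * (6 powr \<epsilon> / \<epsilon>)) / q"
  show thesis
  proof (rule that[of D])
    show "D \<ge> 0" using q \<epsilon> by (simp add: D_def)
    fix k :: nat and I assume I: "finite I"
      and win: "\<And>n. n \<in> I \<Longrightarrow> real k \<le> Im (\<rho> n) \<and> Im (\<rho> n) \<le> real k + 1"
    define c where "c = Complex 2 (real k + 1 / 2)"
    define T where "T = \<rho> ` I"
    define N where "N = (\<Sum>a\<in>T. nat (zorder zeta_numerator a))"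
    have zero: "riemann_zeta (\<rho> n) = 0" "Im (\<rho> n) > 0" for n
      using \<rho> by (auto simp: upper_zeta_zeros_def)
    \<comment> \<open>Indices with the same value \<open>a\<close> number at most its multiplicity,
      which is how repeated zeros enter the count.\<close>
    have card_le: "card I \<le> N"
    proof -
      have "card I = (\<Sum>a\<in>T. card {n \<in> I. \<rho> n = a})"
        using sum.image_gen[OF I, of "\<lambda>_. 1 :: nat" \<rho>] by (simp add: T_def)
      also have "\<dots> \<le> N"
        unfolding N_def
      proof (rule sum_mono)
        fix a assume "a \<in> T"
        then obtain n where n: "a = \<rho> n" by (auto simp: T_def)
        have a: "riemann_zeta a = 0" "Im a > 0" using zero[of n] n by auto
        have fin: "finite {n. \<rho> n = a}" and card: "int (card {n. \<rho> n = a}) = zorder riemann_zeta a"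
          using \<rho> a by (auto simp: upper_zeta_zeros_def)
        have "zorder zeta_numerator a = zorder riemann_zeta a"
          using upper_zeta_zero_location[OF a] a by (intro zorder_zeta_numerator) auto
        hence "card {n. \<rho> n = a} = nat (zorder zeta_numerator a)" using card by simp
        thus "card {n \<in> I. \<rho> n = a} \<le> nat (zorder zeta_numerator a)"
          using card_mono[OF fin, of "{n \<in> I. \<rho> n = a}"] by auto
      qed
      finally show ?thesis .
    qed
    \<comment> \<open>The window lies within 2 horizontally and 1/2 vertically of the centre, and 4
      + 1/4 is below the square of 2.1.\<close>
    have T: "T \<subseteq> cball c 2.1"
    proof
      fix a assume "a \<in> T"
      then obtain n where n: "n \<in> I" "a = \<rho> n" by (auto simp: T_def)
      have "Re a \<ge> 0" "Re a \<le> 1" using upper_zeta_zero_location[OF zero[of n]] n by auto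
      hence "(Re a - 2)\<^sup>2 \<le> 2\<^sup>2" by (intro power2_le_iff_abs_le[THEN iffD2]) auto
      moreover have "\<bar>Im a - (real k + 1 / 2)\<bar> \<le> 1 / 2"
        using win[OF n(1)] unfolding n(2) abs_le_iff by auto
      hence "(Im a - (real k + 1 / 2))\<^sup>2 \<le> (1 / 2)\<^sup>2"
        by (intro power2_le_iff_abs_le[THEN iffD2]) auto
      ultimately have "(norm (a - c))\<^sup>2 \<le> 2.1\<^sup>2"
        unfolding cmod_power2 by (simp add: c_def power2_eq_square)
      hence "norm (a - c) \<le> 2.1" by (rule power2_le_imp_le) simp
      thus "a \<in> cball c 2.1" by (simp add: dist_norm norm_minus_commute)
    qed
    \<comment> \<open>Radius 2.4 around real part 2 reaches only -0.4, inside the half plane of the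
      cubic bound.\<close>
    have near: "Re w \<ge> - 1 / 2 \<and> norm w + 1 \<le> real k + 6" if "w \<in> cball c 2.4" for w
    proof -
      have d: "norm (w - c) \<le> 2.4" using that by (simp add: dist_norm norm_minus_commute)
      have "norm c \<le> 2 + (real k + 1 / 2)"
        using cmod_le[of c] by (simp add: c_def)
      moreover have "norm w \<le> norm c + norm (w - c)" by (rule norm_triangle_sub)
      moreover have "\<bar>Re w - 2\<bar> \<le> norm (w - c)" using abs_Re_le_cmod[of "w - c"] by (simp add: c_def)
      ultimately show ?thesis using d by linarith
    qed
    have nc: "norm (zeta_numerator c) \<ge> \<delta>"
      unfolding \<delta>_def by (rule norm_zeta_numerator_ge) (simp add: c_def)
    have "norm (zeta_numerator c) \<le> K * (real k + 6) ^ 3 * (2.1 / 2.4) ^ N"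
      unfolding N_def
    proof (rule Jensen_bound)
      show "finite T" using I by (simp add: T_def)
      show "T \<subseteq> cball c 2.1" by (rule T)
      show "zeta_numerator holomorphic_on {s. Re s > -1}" by (rule holomorphic_zeta_numerator)
      show "open {s. Re s > -1}" by (rule open_halfspace_Re_gt)
      show "connected {s. Re s > -1}" by (intro convex_connected convex_halfspace_Re_gt)
      show "cball c 2.4 \<subseteq> {s. Re s > -1}" using near by fastforce
      show "zeta_numerator c \<noteq> 0" using nc \<delta> by auto
      fix w assume "w \<in> sphere c 2.4"
      hence w: "w \<in> cball c 2.4" by auto
      have "norm (zeta_numerator w) \<le> K * (norm w + 1) ^ 3" using K(2) near[OF w] by blast
      also have "\<dots> \<le> K * (real k + 6) ^ 3"
        using near[OF w] K(1) by (intro mult_left_mono power_mono) auto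
      finally show "norm (zeta_numerator w) \<le> K * (real k + 6) ^ 3" .
    qed auto
    hence "\<delta> \<le> K * (real k + 6) ^ 3 * (7 / 8) ^ N" using nc by simp
    hence "(8 / 7) ^ N \<le> K / \<delta> * (real k + 6) ^ 3"
      using \<delta> by (simp add: power_divide field_simps)
    hence "ln ((8 / 7) ^ N) \<le> ln (K / \<delta> * (real k + 6) ^ 3)"
      by (subst ln_le_cancel_iff) (use K(1) \<delta> in auto)
    moreover have "ln (K / \<delta> * (real k + 6) ^ 3) = ln (K / \<delta>) + ln ((real k + 6) ^ 3)"
      by (rule ln_mult_pos) (use K(1) \<delta> in auto)
    ultimately have "real N * q \<le> ln (K / \<delta>) + 3 * ln (real k + 6)"
      by (simp add: ln_realpow q_def)
    also have "\<dots> \<le> \<bar>ln (K / \<delta>)\<bar> * (real k + 1) powr \<epsilon> + 3 * (6 powr \<epsilon> / \<epsilon> * (real k + 1) powr \<epsilon>)"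
    proof (intro add_mono mult_left_mono)
      have "1 \<le> (real k + 1) powr \<epsilon>" using \<epsilon> by (intro ge_one_powr_ge_zero) auto
      hence "\<bar>ln (K / \<delta>)\<bar> * 1 \<le> \<bar>ln (K / \<delta>)\<bar> * (real k + 1) powr \<epsilon>" by (intro mult_left_mono) auto
      thus "ln (K / \<delta>) \<le> \<bar>ln (K / \<delta>)\<bar> * (real k + 1) powr \<epsilon>" by linarith
      have "ln (real k + 6) \<le> (real k + 6) powr \<epsilon> / \<epsilon>"
        using \<epsilon> by (intro ln_powr_bound) auto
      also have "\<dots> \<le> (6 * (real k + 1)) powr \<epsilon> / \<epsilon>"
        using \<epsilon> by (intro divide_right_mono powr_mono2) auto
      also have "\<dots> = 6 powr \<epsilon> / \<epsilon> * (real k + 1) powr \<epsilon>"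
        by (subst powr_mult) auto
      finally show "ln (real k + 6) \<le> 6 powr \<epsilon> / \<epsilon> * (real k + 1) powr \<epsilon>" .
    qed auto
    finally have "real N * q \<le> (\<bar>ln (K / \<delta>)\<bar> + 3 * (6 powr \<epsilon> / \<epsilon>)) * (real k + 1) powr \<epsilon>"
      by (simp only: distrib_right mult.assoc)
    hence "real N \<le> (\<bar>ln (K / \<delta>)\<bar> + 3 * (6 powr \<epsilon> / \<epsilon>)) * (real k + 1) powr \<epsilon> / q"
      using q by (simp only: pos_le_divide_eq)
    hence "real N \<le> D * (real k + 1) powr \<epsilon>"
      by (simp add: D_def)
    thus "real (card I) \<le> D * (real k + 1) powr \<epsilon>" using card_le by linarith
  qed
qed

lemma summable_upper_zeta_zeros:
  assumes \<rho>: "upper_zeta_zeros \<rho>" and \<sigma>: "\<sigma> > 1"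
  shows "summable (\<lambda>n. Im (\<rho> n) powr (- \<sigma>))"
proof -
  \<comment> \<open>Half of the excess over 1 pays for the growth of the count: the exponent left is
    \<open>\<epsilon> - \<sigma> = - (1 + \<epsilon>)\<close>.\<close>
  define \<epsilon> where "\<epsilon> = (\<sigma> - 1) / 2"
  have \<epsilon>: "\<epsilon> > 0" using \<sigma> by (simp add: \<epsilon>_def)
  obtain D where D: "D \<ge> 0"
    "\<And>k I. finite I \<Longrightarrow> (\<And>n. n \<in> I \<Longrightarrow> real k \<le> Im (\<rho> n) \<and> Im (\<rho> n) \<le> real k + 1) \<Longrightarrow>
       real (card I) \<le> D * (real k + 1) powr \<epsilon>"
    using card_upper_zeta_zeros_window[OF \<rho> \<epsilon>] by blast
  have y: "Im (\<rho> n) > 1 / 2" for n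
    using \<rho> upper_zeta_zero_location[of "\<rho> n"] by (auto simp: upper_zeta_zeros_def)
  define fl where "fl = (\<lambda>n. nat \<lfloor>Im (\<rho> n)\<rfloor>)"
  have fl: "real (fl n) \<le> Im (\<rho> n)" "Im (\<rho> n) \<le> real (fl n) + 1" for n
    using y[of n] by (simp_all add: fl_def)
  define g where "g = (\<lambda>k. D * 3 powr \<sigma> * (real (Suc k)) powr (- (\<epsilon> - 1 + 2)))"
  have g: "summable g" unfolding g_def using \<epsilon> by (intro summable_mult summable_Suc_powr) auto
  have g0: "g k \<ge> 0" for k using D(1) by (simp add: g_def)
  show ?thesis
  proof (rule summableI_nonneg_bounded)
    fix N
    have "(\<Sum>n<N. Im (\<rho> n) powr (- \<sigma>)) =
        (\<Sum>k\<in>fl ` {..<N}. \<Sum>n\<in>{n \<in> {..<N}. fl n = k}. Im (\<rho> n) powr (- \<sigma>))"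
      by (rule sum.image_gen) simp
    also have "\<dots> \<le> (\<Sum>k\<in>fl ` {..<N}. g k)"
    proof (rule sum_mono)
      fix k
      let ?I = "{n \<in> {..<N}. fl n = k}"
      have "(\<Sum>n\<in>?I. Im (\<rho> n) powr (- \<sigma>)) \<le> (\<Sum>n\<in>?I. ((real k + 1) / 3) powr (- \<sigma>))"
      proof (rule sum_mono)
        fix n assume "n \<in> ?I"
        \<comment> \<open>For \<open>k = 0\<close> this uses the lower bound 1/2 on heights; for
          larger \<open>k\<close> already \<open>k\<close> is at least
          \<open>(k + 1) / 3\<close>.\<close>
        hence "(real k + 1) / 3 \<le> Im (\<rho> n)" using fl[of n] y[of n] by auto
        thus "Im (\<rho> n) powr (- \<sigma>) \<le> ((real k + 1) / 3) powr (- \<sigma>)"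
          using \<sigma> by (intro powr_mono2') auto
      qed
      also have "\<dots> = real (card ?I) * ((real k + 1) / 3) powr (- \<sigma>)" by simp
      also have "\<dots> \<le> D * (real k + 1) powr \<epsilon> * ((real k + 1) / 3) powr (- \<sigma>)"
        using fl by (intro mult_right_mono D(2)) auto
      also have "\<dots> = g k"
      proof -
        have "((real k + 1) / 3) powr (- \<sigma>) = 3 powr \<sigma> * (real k + 1) powr (- \<sigma>)"
          by (simp add: powr_divide powr_minus field_simps)
        moreover have "(real k + 1) powr \<epsilon> * (real k + 1) powr (- \<sigma>) = (real k + 1) powr (- (\<epsilon> - 1 + 2))"
        proof -
          have "\<epsilon> + - \<sigma> = - (\<epsilon> - 1 + 2)" by (simp add: \<epsilon>_def field_simps)
          thus ?thesis by (simp only: powr_add[symmetric])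
        qed
        ultimately show ?thesis by (simp add: g_def mult_ac add.commute)
      qed
      finally show "(\<Sum>n\<in>?I. Im (\<rho> n) powr (- \<sigma>)) \<le> g k" .
    qed
    also have "\<dots> \<le> suminf g" by (intro sum_le_suminf g) (auto simp: g0)
    finally show "(\<Sum>n<N. Im (\<rho> n) powr (- \<sigma>)) \<le> suminf g" .
  qed auto
qed

text \<open>The argument of \<open>a\<close> is below pi/2 in absolute value, so doubling it stays
  in the principal range and \<open>Ln (a * a) = 2 * Ln a\<close>.\<close>

lemma power2_powr_half:
  fixes a :: complex
  assumes "Re a > 0"
  shows "(a\<^sup>2) powr (- (s / 2)) = a powr (- s)"
proof -
  have a: "a \<noteq> 0" using assms by auto
  have "\<bar>Im (Ln a)\<bar> < pi / 2" using assms a Re_Ln_pos_lt by blast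
  hence "Ln (a * a) = Ln a + Ln a" using a by (intro Ln_times_simple) auto
  thus ?thesis using a by (simp add: powr_def power2_eq_square)
qed

theorem theorem3p2:
  fixes \<rho> \<alpha> :: "nat \<Rightarrow> complex" and s :: complex
  assumes "upper_zeta_zeros \<rho>"
    and "\<And>n. \<rho> n = 1/2 + \<i> * \<alpha> n"
    and "Re s > 1"
  shows "set_integrable lborel {0<..}
           (\<lambda>x::real. zeros_theta \<alpha> (of_real x) * of_real x powr (s / 2) / of_real x)
       \<and> Gamma (s / 2) * secondary_zeta \<alpha> s =
           (LINT x:{0<..}|lborel. zeros_theta \<alpha> (of_real x) * of_real x powr (s / 2) / of_real x)"
proof -
  define y where "y = (\<lambda>n. Im (\<rho> n))"
  have loc: "0 \<le> Re (\<rho> n)" "Re (\<rho> n) \<le> 1" "y n > 1 / 2" for n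
    using assms(1) upper_zeta_zero_location[of "\<rho> n"] by (auto simp: upper_zeta_zeros_def y_def)
  have Re\<alpha>: "Re (\<alpha> n) = y n" and Im\<alpha>: "Im (\<alpha> n) = 1 / 2 - Re (\<rho> n)" for n
    using assms(2)[of n] by (simp_all add: y_def)
  \<comment> \<open>From \<open>y\<^sup>2 - 1/4 \<ge> \<kappa> * y\<^sup>2\<close> for all
    \<open>y \<ge> y 0\<close>, with equality at the lowest height; positive because
    \<open>y 0 > 1 / 2\<close>.\<close>
  define \<kappa> where "\<kappa> = 1 - 1 / (4 * (y 0)\<^sup>2)"
  have "(1 / 2)\<^sup>2 < (y 0)\<^sup>2" using loc(3)[of 0] by (intro power_strict_mono) auto
  hence \<kappa>: "\<kappa> > 0" by (simp add: \<kappa>_def field_simps power2_eq_square)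
  define w where "w = (\<lambda>n. (\<alpha> n)\<^sup>2)"
  have w: "Re (w n) \<ge> \<kappa> * (y n)\<^sup>2" for n
  proof -
    have "incseq y" using assms(1) by (auto simp: y_def upper_zeta_zeros_def intro: incseq_SucI)
    hence "y 0 \<le> y n" by (simp add: incseqD)
    hence "(y 0)\<^sup>2 \<le> (y n)\<^sup>2" using loc(3)[of 0] by (intro power_mono) auto
    hence "1 / 4 \<le> (y n)\<^sup>2 / (4 * (y 0)\<^sup>2)" using loc(3)[of 0] by (simp add: field_simps)
    moreover have "\<bar>1 / 2 - Re (\<rho> n)\<bar> \<le> 1 / 2"
      using loc(1,2)[of n] by linarith
    hence "(1 / 2 - Re (\<rho> n))\<^sup>2 \<le> (1 / 2)\<^sup>2"
      by (intro power2_le_iff_abs_le[THEN iffD2]) auto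
    moreover have "Re (w n) = (y n)\<^sup>2 - (1 / 2 - Re (\<rho> n))\<^sup>2"
      by (simp add: w_def Re_power2 Re\<alpha> Im\<alpha>)
    ultimately show ?thesis by (simp add: \<kappa>_def power2_eq_square algebra_simps)
  qed
  have y0: "y n > 0" for n using loc(3)[of n] by linarith
  have w0: "Re (w n) > 0" for n
    using w[of n] \<kappa> y0[of n] by (smt (verit) mult_pos_pos zero_less_power)
  have sy: "summable (\<lambda>n. y n powr (- \<sigma>))" if "\<sigma> > 1" for \<sigma>
    unfolding y_def by (rule summable_upper_zeta_zeros[OF assms(1) that])
  have s2: "Re (s / 2) > 0" using assms(3) by simp

  let ?f = "\<lambda>n t. complex_of_real t powr (s / 2 - 1) * exp (- (w n * of_real t))"
  let ?v = "\<lambda>n. Gamma (s / 2) * w n powr (- (s / 2))"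
  let ?u = "\<lambda>n. Gamma (Re (s / 2)) * Re (w n) powr (- Re (s / 2))"
  have f: "has_set_integral (?f n) (?v n) {0<..}" for n
    by (rule has_set_integral_Gamma_scaled[OF s2 w0])
  have nf: "norm (?f n t) = t powr (Re (s / 2) - 1) * exp (- (Re (w n) * t))" if "t > 0" for n t
    using that by (simp add: norm_mult norm_of_real_powr)
  \<comment> \<open>Since exp x is at least x, each term is at most a constant times
    \<open>y n powr (- 2)\<close>.\<close>
  have sme: "summable (\<lambda>n. exp (- (Re (w n) * t)))" if t: "t > 0" for t
  proof (rule summable_comparison_test'[of "\<lambda>n. 1 / (\<kappa> * t) * y n powr (- 2)" 0])
    show "summable (\<lambda>n. 1 / (\<kappa> * t) * y n powr (- 2))" by (intro summable_mult sy) simp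
    fix n :: nat
    have "\<kappa> * (y n)\<^sup>2 * t \<le> Re (w n) * t" using w[of n] t by (intro mult_right_mono) auto
    also have "\<dots> \<le> exp (Re (w n) * t)" using exp_ge_add_one_self[of "Re (w n) * t"] by linarith
    finally have "inverse (exp (Re (w n) * t)) \<le> inverse (\<kappa> * (y n)\<^sup>2 * t)"
      using \<kappa> y0[of n] t by (intro le_imp_inverse_le) auto
    also have "\<dots> = 1 / (\<kappa> * t) * y n powr (- 2)"
      using y0[of n] by (simp add: powr_minus field_simps)
    finally show "norm (exp (- (Re (w n) * t))) \<le> 1 / (\<kappa> * t) * y n powr (- 2)"
      by (simp add: exp_minus)
  qed
  have smf: "summable (\<lambda>n. norm (?f n t))" if "t \<in> {0<..}" for t
    using that sme[of t] by (simp only: nf greaterThan_iff summable_mult)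
  have n: "has_set_integral (\<lambda>t. norm (?f n t)) (?u n) {0<..}" for n
  proof -
    have "has_set_integral (\<lambda>t. t powr (Re (s / 2) - 1) * exp (- (Re (w n) * t))) (?u n) {0<..}"
      by (rule has_set_integral_norm_Gamma_scaled[OF s2 w0])
    also have "?this \<longleftrightarrow> ?thesis"
      by (intro has_set_integral_cong refl) (simp only: nf greaterThan_iff)
    finally show ?thesis .
  qed
  have u: "summable ?u"
  proof (rule summable_mult, rule summable_comparison_test'[of "\<lambda>n. \<kappa> powr (- Re (s / 2)) * y n powr (- Re s)" 0])
    show "summable (\<lambda>n. \<kappa> powr (- Re (s / 2)) * y n powr (- Re s))"
      by (intro summable_mult sy assms(3))
    fix n :: nat
    have "Re (w n) powr (- Re (s / 2)) \<le> (\<kappa> * (y n)\<^sup>2) powr (- Re (s / 2))"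
      using w[of n] \<kappa> y0[of n] s2 by (intro powr_mono2') auto
    also have "\<dots> = \<kappa> powr (- Re (s / 2)) * (y n powr 2) powr (- Re (s / 2))"
      using \<kappa> y0[of n] by (simp add: powr_mult)
    also have "\<dots> = \<kappa> powr (- Re (s / 2)) * y n powr (- Re s)"
      unfolding powr_powr by simp
    finally show "norm (Re (w n) powr (- Re (s / 2))) \<le> \<kappa> powr (- Re (s / 2)) * y n powr (- Re s)"
      by simp
  qed
  have sv: "summable ?v"
    by (rule has_set_integral_suminf(2)[OF f smf n u])
  have "has_set_integral (\<lambda>t. \<Sum>n. ?f n t) (\<Sum>n. ?v n) {0<..}"
    by (rule has_set_integral_suminf(1)[OF f smf n u])
  also have "?this \<longleftrightarrow>
      has_set_integral (\<lambda>x. zeros_theta \<alpha> (of_real x) * of_real x powr (s / 2) / of_real x)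
        (Gamma (s / 2) * secondary_zeta \<alpha> s) {0<..}"
  proof (rule has_set_integral_cong)
    fix t :: real assume "t \<in> {0<..}"
    hence t: "t > 0" by simp
    have "summable (\<lambda>n. exp (- (w n * of_real t)))"
      by (rule summable_norm_cancel) (use sme[OF t] in simp)
    hence "(\<Sum>n. ?f n t) = of_real t powr (s / 2 - 1) * (\<Sum>n. exp (- (w n * of_real t)))"
      by (rule suminf_mult)
    also have "\<dots> = zeros_theta \<alpha> (of_real t) * of_real t powr (s / 2) / of_real t"
      using t by (simp add: zeros_theta_def w_def powr_diff)
    finally show "(\<Sum>n. ?f n t) = zeros_theta \<alpha> (of_real t) * of_real t powr (s / 2) / of_real t" .
  next
    have "w n powr (- (s / 2)) = \<alpha> n powr (- s)" for n
      unfolding w_def by (rule power2_powr_half) (simp add: Re\<alpha> y0)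
    \<comment> \<open>Cancelling the nonzero factor turns summability of \<open>?v\<close> into
      convergence of the series of \<open>secondary_zeta\<close>, so that the constant may be pulled
      out of the infinite sum.\<close>
    moreover have "Gamma (s / 2) \<noteq> 0"
      using s2 by (simp add: Gamma_eq_zero_iff Re_pos_not_nonpos_Int)
    ultimately show "(\<Sum>n. ?v n) = Gamma (s / 2) * secondary_zeta \<alpha> s"
      using sv unfolding secondary_zeta_def by (simp add: suminf_mult)
  qed
  finally show ?thesis by (simp add: has_set_integral_def)
qed

end
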